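(* Let $N\ge1$ and let $H=(H_1,\dots,H_N):\mathbf{R}_+^N\to(0,1)^N$ be a measurable function. Let $X=\{X_t;\,t\in\mathbf{R}_+^N\}$ be the multifractional Brownian sheet defined by $$X_t=\int_{\mathbf{R}^N}\prod_{m=1}^N\left[|t_m-u_m|^{H_m(t)-\frac12}-|u_m|^{H_m(t)-\frac12}\right]\mathbb{W}(du),$$ and let $Y=\{Y_t;\,t\in\mathbf{R}_+^N\}$ be the process $$Y_t=\hat W(\phi_t)=\int_{\mathbf{R}^N}\prod_{m=1}^N\frac{e^{it_m\xi_m}-1}{|\xi_m|^{H_m(t)+\frac12}}\,\hat{\mathbb{W}}(d\xi),\qquad \phi_t(\xi)=\prod_{m=1}^N\frac{e^{it_m\xi_m}-1}{|\xi_m|^{H_m(t)+\frac12}}.$$ Then $X$ and $Y$ are indistinguishable up to a multiplicative deterministic function; that is, there is a deterministic function $\lambda$ on $\mathbf{R}_+^N$ such that $\{X_t\}$ and $\{\lambda(t)Y_t\}$ are indistinguishable.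
   Context: $\mathbf{R}_+=[0,\infty)$. $L^2_{\mathbf C}(\mathbf{R}^N)$ is the space of square-integrable functions $\mathbf{R}^N\to\mathbf{C}$. The complex isonormal process is a centered Gaussian process $W=\{W(f);f\in L^2_{\mathbf C}(\mathbf{R}^N)\}$ (linear in $f$, with $W(f)$ almost surely real for real $f$) such that $E[W(f)\overline{W(g)}]=\int_{\mathbf{R}^N}f(u)\overline{g(u)}\,du$. White noise is $\mathbb{W}(E)=W(\mathbf 1_E)$, and $\int f(u)\,\mathbb{W}(du)=W(f)$. The Fourier transform of $W$ is $\hat W(f)=W(\hat f)$, where $\hat f$ is the Fourier transform of $f$; the Fourier transform $\hat{\mathbb{W}}$ of white noise is defined in the same way and $\int f(\xi)\,\hat{\mathbb{W}}(d\xi)=\hat W(f)$. Here $\mathbb{W}$ and $\hat{\mathbb{W}}$ come from the same isonormal process $W$. Two processes are indistinguishable if almost surely they coincide for all $t$ simultaneously. *)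

theory Defs
  imports "HOL-Probability.Probability"
begin

text \<open>Elements of complex \<open>L\<^sup>2\<close> are represented by Borel functions; the identification of functions that
  agree almost everywhere is made where such functions are used.\<close>

definition L2C :: "('a::euclidean_space \<Rightarrow> complex) set" where
  "L2C = {f \<in> borel_measurable lborel. integrable lborel (\<lambda>u. (norm (f u))\<^sup>2)}"

definition L2_tendsto ::
  "(nat \<Rightarrow> 'a::euclidean_space \<Rightarrow> complex) \<Rightarrow> ('a \<Rightarrow> complex) \<Rightarrow> bool" where
  "L2_tendsto F f \<longleftrightarrow>
     (\<lambda>n. \<integral>\<^sup>+ u. ennreal ((norm (F n u - f u))\<^sup>2) \<partial>lborel) \<longlonglongrightarrow> 0"

definition fourier_L1 :: "('a::euclidean_space \<Rightarrow> complex) \<Rightarrow> 'a \<Rightarrow> complex" where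
  "fourier_L1 f \<xi> = (\<integral> u. cis (- (u \<bullet> \<xi>)) * f u \<partial>lborel)"

text \<open>The Fourier transform on \<open>L\<^sup>2\<close> is the continuous extension of the integral transform from
  \<open>L\<^sup>1 \<inter> L\<^sup>2\<close>. It is determined only up to a null set, whence the choice of a representative.\<close>

definition is_fourier_L2 ::
  "('a::euclidean_space \<Rightarrow> complex) \<Rightarrow> ('a \<Rightarrow> complex) \<Rightarrow> bool" where
  "is_fourier_L2 f g \<longleftrightarrow> f \<in> L2C \<and> g \<in> L2C \<and>
     (\<exists>F. (\<forall>n. integrable lborel (F n) \<and> F n \<in> L2C) \<and>
          L2_tendsto F f \<and> L2_tendsto (\<lambda>n. fourier_L1 (F n)) g)"

definition fourier_L2 :: "('a::euclidean_space \<Rightarrow> complex) \<Rightarrow> 'a \<Rightarrow> complex" where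
  "fourier_L2 f = (SOME g. is_fourier_L2 f g)"

text \<open>Degenerate Gaussian variables are admitted.\<close>

definition centered_gaussian :: "'w measure \<Rightarrow> ('w \<Rightarrow> real) \<Rightarrow> bool" where
  "centered_gaussian M Z \<longleftrightarrow> Z \<in> borel_measurable M \<and>
     ((AE \<omega> in M. Z \<omega> = 0) \<or>
      (\<exists>\<sigma>>0. distributed M lborel Z (\<lambda>x. ennreal (normal_density 0 \<sigma> x))))"

definition centered_gaussian_process ::
  "'w measure \<Rightarrow> 'i set \<Rightarrow> ('i \<Rightarrow> 'w \<Rightarrow> complex) \<Rightarrow> bool" where
  "centered_gaussian_process M T Z \<longleftrightarrow>
     (\<forall>i\<in>T. Z i \<in> borel_measurable M) \<and>
     (\<forall>J a b. finite J \<and> J \<subseteq> T \<longrightarrow>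
        centered_gaussian M (\<lambda>\<omega>. \<Sum>i\<in>J. (a i * Re (Z i \<omega>) + b i * Im (Z i \<omega>))))"

text \<open>The second condition says that the index set consists of almost-everywhere classes.
  Linearity is a property of the sample paths: the exceptional null set does not depend on the
  functions and scalars. With a null set for each linear relation, uncountably many of them
  could not be handled at once and processes built from \<open>W\<close> would only be defined up to
  modification.\<close>

definition complex_isonormal ::
  "'w measure \<Rightarrow> (('a::euclidean_space \<Rightarrow> complex) \<Rightarrow> 'w \<Rightarrow> complex) \<Rightarrow> bool" where
  "complex_isonormal M W \<longleftrightarrow>
     centered_gaussian_process M L2C W \<and>
     (\<forall>f\<in>L2C. \<forall>g\<in>L2C. (AE u in lborel. f u = g u) \<longrightarrow> W f = W g) \<and>
     (AE \<omega> in M. \<forall>f\<in>L2C. \<forall>g\<in>L2C. \<forall>a b.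
        W (\<lambda>u. a * f u + b * g u) \<omega> = a * W f \<omega> + b * W g \<omega>) \<and>
     (\<forall>f\<in>L2C. (\<forall>u. f u \<in> \<real>) \<longrightarrow> (AE \<omega> in M. W f \<omega> \<in> \<real>)) \<and>
     (\<forall>f\<in>L2C. \<forall>g\<in>L2C.
        (\<integral> \<omega>. W f \<omega> * cnj (W g \<omega>) \<partial>M) = (\<integral> u. f u * cnj (g u) \<partial>lborel))"

definition fourier_isonormal ::
  "(('a::euclidean_space \<Rightarrow> complex) \<Rightarrow> 'w \<Rightarrow> complex) \<Rightarrow> ('a \<Rightarrow> complex) \<Rightarrow> 'w \<Rightarrow> complex" where
  "fourier_isonormal W f = W (fourier_L2 f)"

definition indistinguishable ::
  "'w measure \<Rightarrow> 'i set \<Rightarrow> ('i \<Rightarrow> 'w \<Rightarrow> 'b) \<Rightarrow> ('i \<Rightarrow> 'w \<Rightarrow> 'b) \<Rightarrow> bool" where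
  "indistinguishable M T X Y \<longleftrightarrow> (AE \<omega> in M. \<forall>t\<in>T. X t \<omega> = Y t \<omega>)"

definition orthant :: "(real ^ 'n) set" where
  "orthant = {t. \<forall>m. 0 \<le> t $ m}"

text \<open>The conventions \<open>0 powr a = 0\<close> and \<open>x / 0 = 0\<close> affect the following kernels on null sets only.\<close>

definition mfbs_kernel :: "(real ^ 'n \<Rightarrow> real ^ 'n) \<Rightarrow> real ^ 'n \<Rightarrow> real ^ 'n \<Rightarrow> complex" where
  "mfbs_kernel H t u =
     complex_of_real
       (\<Prod>m\<in>UNIV. (\<bar>t $ m - u $ m\<bar> powr (H t $ m - 1/2) - \<bar>u $ m\<bar> powr (H t $ m - 1/2)))"

definition harmonizable_kernel ::
  "(real ^ 'n \<Rightarrow> real ^ 'n) \<Rightarrow> real ^ 'n \<Rightarrow> real ^ 'n \<Rightarrow> complex" where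
  "harmonizable_kernel H t \<xi> =
     (\<Prod>m\<in>UNIV. (exp (\<i> * of_real (t $ m * \<xi> $ m)) - 1) / of_real (\<bar>\<xi> $ m\<bar> powr (H t $ m + 1/2)))"

text \<open>The integral of \<open>f\<close> against the white noise \<open>E \<mapsto> W (indicator E)\<close> is \<open>W f\<close>, and similarly
  for the Fourier transform of white noise.\<close>

definition multifractional_sheet ::
  "((real ^ 'n \<Rightarrow> complex) \<Rightarrow> 'w \<Rightarrow> complex) \<Rightarrow> (real ^ 'n \<Rightarrow> real ^ 'n) \<Rightarrow>
     real ^ 'n \<Rightarrow> 'w \<Rightarrow> complex" where
  "multifractional_sheet W H t = W (mfbs_kernel H t)"

definition harmonizable_sheet ::
  "((real ^ 'n \<Rightarrow> complex) \<Rightarrow> 'w \<Rightarrow> complex) \<Rightarrow> (real ^ 'n \<Rightarrow> real ^ 'n) \<Rightarrow>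
     real ^ 'n \<Rightarrow> 'w \<Rightarrow> complex" where
  "harmonizable_sheet W H t = fourier_isonormal W (harmonizable_kernel H t)"

end

theory Submission
  imports Defs
begin

text \<open>For each fixed \<open>t\<close> the kernel \<open>mfbs_kernel H t\<close> is, up to a real constant and a null set, the
  \<open>L\<^sup>2\<close> Fourier transform of \<open>harmonizable_kernel H t\<close>; since \<open>W\<close> is linear outside a single
  null set, this identity of kernels transfers to all \<open>t\<close> simultaneously. If some \<open>H t $ m = 1/2\<close>,
  the first kernel vanishes almost everywhere and the constant is \<open>0\<close>.

  No full Plancherel theorem is needed. Integrating \<open>\<bar>fourier_L1 f\<bar>\<^sup>2\<close> against a Gaussian weight
  and using Fubini gives the inequality \<open>\<parallel>fourier_L1 f\<parallel>\<^sup>2 \<le> (2 \<pi>)\<^sup>N \<parallel>f\<parallel>\<^sup>2\<close>. It implies that the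
  transform on \<open>L\<^sup>2\<close> is unique, and with Fatou's lemma that an almost everywhere limit of the
  transforms of an \<open>L\<^sup>2\<close>-convergent sequence is the transform of the limit. The harmonizable kernel
  is truncated coordinatewise to \<open>1/n \<le> \<bar>\<xi>\<^sub>m\<bar> \<le> n\<close>, and the transforms of the truncated factors
  converge pointwise by elementary one-dimensional calculus.\<close>

section \<open>A Plancherel inequality\<close>

text \<open>The value lies in \<open>ennreal\<close>, so norm estimates can be stated before square
  integrability is known; for a measurable function outside \<open>L2C\<close> it is
  infinite.\<close>

definition sqnorm_L2 :: "('a::euclidean_space \<Rightarrow> complex) \<Rightarrow> ennreal" where
  "sqnorm_L2 f = (\<integral>\<^sup>+ u. ennreal ((norm (f u))\<^sup>2) \<partial>lborel)"

lemma L2_tendsto_iff: "L2_tendsto F f \<longleftrightarrow> (\<lambda>n. sqnorm_L2 (\<lambda>u. F n u - f u)) \<longlonglongrightarrow> 0"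
  by (simp add: L2_tendsto_def sqnorm_L2_def)

lemma L2C_iff: "f \<in> L2C \<longleftrightarrow> f \<in> borel_measurable borel \<and> sqnorm_L2 f < \<infinity>"
  by (auto simp: L2C_def sqnorm_L2_def integrable_iff_bounded)

lemma sqnorm_L2_diff_commute:
  "sqnorm_L2 (\<lambda>u. f u - g u) = sqnorm_L2 (\<lambda>u. g u - f u)"
  by (simp add: sqnorm_L2_def norm_minus_commute)

text \<open>Since (a + b)^2 \<le> 2 a^2 + 2 b^2, squared norms obey a triangle inequality up to a
  factor 2. The factor is harmless: the estimate only serves to show finiteness and convergence to
  0.\<close>

lemma sqnorm_L2_triangle:
  assumes [measurable]: "f \<in> borel_measurable borel" "g \<in> borel_measurable borel" "h \<in> borel_measurable borel"
  shows "sqnorm_L2 (\<lambda>u. f u - h u) \<le>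
    2 * sqnorm_L2 (\<lambda>u. f u - g u) + 2 * sqnorm_L2 (\<lambda>u. g u - h u)"
proof -
  have le: "(norm (f u - h u))\<^sup>2 \<le> 2 * (norm (f u - g u))\<^sup>2 + 2 * (norm (g u - h u))\<^sup>2" for u
  proof -
    have "norm (f u - h u) \<le> norm (f u - g u) + norm (g u - h u)"
      using dist_triangle[of "f u" "h u" "g u"] by (simp add: dist_norm)
    then have "(norm (f u - h u))\<^sup>2 \<le> (norm (f u - g u) + norm (g u - h u))\<^sup>2"
      by (intro power_mono) auto
    also have "\<dots> \<le> 2 * (norm (f u - g u))\<^sup>2 + 2 * (norm (g u - h u))\<^sup>2"
      using sum_squares_bound[of "norm (f u - g u)" "norm (g u - h u)"]
      by (simp add: power2_sum)
    finally show ?thesis .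
  qed
  have "sqnorm_L2 (\<lambda>u. f u - h u) \<le>
      (\<integral>\<^sup>+ u. 2 * ennreal ((norm (f u - g u))\<^sup>2) + 2 * ennreal ((norm (g u - h u))\<^sup>2) \<partial>lborel)"
    unfolding sqnorm_L2_def
  proof (intro nn_integral_mono)
    fix u
    have "ennreal ((norm (f u - h u))\<^sup>2) \<le> ennreal (2 * (norm (f u - g u))\<^sup>2 + 2 * (norm (g u - h u))\<^sup>2)"
      using le by (intro ennreal_leI)
    also have "\<dots> = 2 * ennreal ((norm (f u - g u))\<^sup>2) + 2 * ennreal ((norm (g u - h u))\<^sup>2)"
      by (simp add: ennreal_mult')
    finally show "ennreal ((norm (f u - h u))\<^sup>2) \<le> \<dots>" .
  qed
  also have "\<dots> = 2 * sqnorm_L2 (\<lambda>u. f u - g u) + 2 * sqnorm_L2 (\<lambda>u. g u - h u)"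
    unfolding sqnorm_L2_def by (simp add: nn_integral_add nn_integral_cmult)
  finally show ?thesis .
qed

lemma measurable_cis [measurable]: "cis \<in> borel_measurable borel"
  by (intro borel_measurable_continuous_onI continuous_intros)

lemma measurable_cnj [measurable]: "cnj \<in> borel_measurable borel"
  by (intro borel_measurable_continuous_onI continuous_intros)

lemma cis_sum: "cis (sum f A) = (\<Prod>x\<in>A. cis (f x))"
  by (induction A rule: infinite_finite_induct) (auto simp: cis_mult[symmetric])

lemma cis_inner: "cis (x \<bullet> y) = (\<Prod>b\<in>Basis. cis ((x \<bullet> b) * (y \<bullet> b)))"
  by (subst euclidean_inner) (rule cis_sum)

lemma fourier_L1_measurable [measurable]:
  assumes [measurable]: "f \<in> borel_measurable borel"
  shows "fourier_L1 f \<in> borel_measurable borel"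
proof -
  have "fourier_L1 f = (\<lambda>\<xi>. \<integral> u. cis (- (u \<bullet> \<xi>)) * f u \<partial>lborel)"
    by (simp add: fun_eq_iff fourier_L1_def)
  then show ?thesis by simp
qed

lemma fourier_L1_diff:
  assumes "integrable lborel f" "integrable lborel g"
  shows "fourier_L1 (\<lambda>u. f u - g u) \<xi> = fourier_L1 f \<xi> - fourier_L1 g \<xi>"
proof -
  have *: "integrable lborel (\<lambda>u. cis (- (u \<bullet> \<xi>)) * h u)" if "integrable lborel h" for h
    by (rule Bochner_Integration.integrable_bound[OF that]) (use that in \<open>auto simp: norm_mult\<close>)
  show ?thesis
    unfolding fourier_L1_def using *[OF assms(1)] *[OF assms(2)]
    by (simp add: right_diff_distrib)
qed

text \<open>\<open>lborel\<close> is the image of the product of one-dimensional Lebesgue measures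
  under the coordinate map, so Fubini's theorem for finite products applies.\<close>

lemma integrable_lborel_prod:
  fixes f :: "'a::euclidean_space \<Rightarrow> real \<Rightarrow> 'c::{real_normed_field,banach,second_countable_topology}"
  assumes "\<And>b. b \<in> Basis \<Longrightarrow> integrable lborel (f b)"
  shows "integrable (lborel :: 'a measure) (\<lambda>x. \<Prod>b\<in>Basis. f b (x \<bullet> b))"
    and "(\<integral>x. (\<Prod>b\<in>Basis. f b (x \<bullet> b)) \<partial>(lborel :: 'a measure)) = (\<Prod>b\<in>Basis. \<integral>x. f b x \<partial>lborel)"
proof -
  interpret product_sigma_finite "\<lambda>b::'a. lborel :: real measure" ..
  have [measurable]: "f b \<in> borel_measurable borel" if "b \<in> Basis" for b
    using assms[OF that] by auto
  have eq: "(\<Prod>b\<in>Basis. f b ((\<Sum>c\<in>Basis. x c *\<^sub>R c) \<bullet> b)) = (\<Prod>b\<in>Basis. f b (x b))" for x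
    by (intro prod.cong refl) simp
  show "integrable (lborel :: 'a measure) (\<lambda>x. \<Prod>b\<in>Basis. f b (x \<bullet> b))"
    unfolding lborel_eq[where 'a='a]
    by (subst integrable_distr_eq) (auto simp: eq intro!: product_integrable_prod assms)
  show "(\<integral>x. (\<Prod>b\<in>Basis. f b (x \<bullet> b)) \<partial>(lborel :: 'a measure)) = (\<Prod>b\<in>Basis. \<integral>x. f b x \<partial>lborel)"
    unfolding lborel_eq[where 'a='a]
    by (subst integral_distr) (auto simp: eq lborel_eq[symmetric] intro!: product_integral_prod assms)
qed

section \<open>Gaussian weights and their transforms\<close>

lemma gaussian_fourier_real:
  assumes "\<sigma> > 0"
  shows "integrable lborel (\<lambda>s. exp (- (\<sigma> * s)\<^sup>2 / 2))"
    and "(\<integral>s. cis (t * s) * of_real (exp (- (\<sigma> * s)\<^sup>2 / 2)) \<partial>lborel) = of_real (2 * pi * normal_density 0 \<sigma> t)"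
proof -
  have "integrable lborel (\<lambda>s. sqrt (2 * pi) * std_normal_density s)"
    by (intro integrable_mult_right integrable_normal_density) simp
  then have "integrable lborel (\<lambda>s::real. exp (- s\<^sup>2 / 2))"
    by (simp add: std_normal_density_def)
  from lborel_integrable_real_affine[OF this, of \<sigma> 0] assms
  show "integrable lborel (\<lambda>s. exp (- (\<sigma> * s)\<^sup>2 / 2))" by simp
  \<comment> \<open>The characteristic function of the standard normal law, read as an integral
    against its density. General \<sigma> follows by the substitution s \<mapsto> s /
    \<sigma>.\<close>
  have "(\<integral>s. std_normal_density s *\<^sub>R cis (r * s) \<partial>lborel) = of_real (exp (- r\<^sup>2 / 2))" for r
    using fun_cong[OF char_std_normal_distribution, of r]
    unfolding char_def by (subst (asm) integral_density) (auto simp: cis_conv_exp)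
  then have "of_real (sqrt (2 * pi)) * (\<integral>s. std_normal_density s *\<^sub>R cis (r * s) \<partial>lborel)
      = of_real (sqrt (2 * pi) * exp (- r\<^sup>2 / 2))" for r by simp
  moreover have "of_real (sqrt (2 * pi)) * (\<integral>s. std_normal_density s *\<^sub>R cis (r * s) \<partial>lborel)
      = (\<integral>s. cis (r * s) * of_real (exp (- s\<^sup>2 / 2)) \<partial>lborel)" for r
    unfolding integral_mult_right_zero[symmetric]
    by (intro Bochner_Integration.integral_cong refl)
       (simp add: std_normal_density_def scaleR_conv_of_real field_simps)
  ultimately have *: "(\<integral>s. cis (r * s) * of_real (exp (- s\<^sup>2 / 2)) \<partial>lborel)
      = of_real (sqrt (2 * pi) * exp (- r\<^sup>2 / 2))" for r by simp
  have "(\<integral>s. cis (t * s) * of_real (exp (- (\<sigma> * s)\<^sup>2 / 2)) \<partial>lborel)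
      = of_real (1 / \<sigma>) * (\<integral>s. cis (t / \<sigma> * s) * of_real (exp (- s\<^sup>2 / 2)) \<partial>lborel)"
    using assms by (subst lborel_integral_real_affine[of "1 / \<sigma>" _ 0])
      (simp_all add: scaleR_conv_of_real)
  also have "\<dots> = of_real (1 / \<sigma> * (sqrt (2 * pi) * exp (- (t / \<sigma>)\<^sup>2 / 2)))"
    by (subst *) (simp only: of_real_mult)
  also have "1 / \<sigma> * (sqrt (2 * pi) * exp (- (t / \<sigma>)\<^sup>2 / 2)) = 2 * pi * normal_density 0 \<sigma> t"
  proof -
    have "sqrt (2 * pi) * sqrt (2 * pi) = 2 * pi" by simp
    then have "2 * pi / sqrt (2 * pi * \<sigma>\<^sup>2) = sqrt (2 * pi) / \<sigma>"
      using assms by (simp add: real_sqrt_mult field_simps)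
    moreover have "2 * pi * normal_density 0 \<sigma> t = 2 * pi / sqrt (2 * pi * \<sigma>\<^sup>2) * exp (- (t / \<sigma>)\<^sup>2 / 2)"
      by (simp add: normal_density_def power_divide)
    ultimately show ?thesis by simp
  qed
  finally show "(\<integral>s. cis (t * s) * of_real (exp (- (\<sigma> * s)\<^sup>2 / 2)) \<partial>lborel) = of_real (2 * pi * normal_density 0 \<sigma> t)" .
qed

text \<open>A convergence factor: integrable for \<sigma> > 0, and tending to 1 pointwise as
  \<sigma> tends to 0.\<close>

definition gaussian_weight :: "real \<Rightarrow> 'a::euclidean_space \<Rightarrow> real" where
  "gaussian_weight \<sigma> \<xi> = (\<Prod>b\<in>Basis. exp (- (\<sigma> * (\<xi> \<bullet> b))\<^sup>2 / 2))"

text \<open>The transform of \<open>gaussian_weight\<close>, by \<open>gaussian_fourier\<close>. Its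
  total mass (2 \<pi>)^N is the source of the Plancherel constant.\<close>

definition gaussian_kernel :: "real \<Rightarrow> 'a::euclidean_space \<Rightarrow> real" where
  "gaussian_kernel \<sigma> x = (\<Prod>b\<in>Basis. 2 * pi * normal_density 0 \<sigma> (x \<bullet> b))"

lemma gaussian_measurable [measurable]:
  "gaussian_weight \<sigma> \<in> borel_measurable borel" "gaussian_kernel \<sigma> \<in> borel_measurable borel"
  unfolding gaussian_weight_def[abs_def] gaussian_kernel_def[abs_def] by measurable

lemma gaussian_nonneg: "0 \<le> gaussian_weight \<sigma> x" "0 \<le> gaussian_kernel \<sigma> x"
  by (auto simp: gaussian_weight_def gaussian_kernel_def intro!: prod_nonneg)

lemma gaussian_weight_integrable:
  "\<sigma> > 0 \<Longrightarrow> integrable lborel (gaussian_weight \<sigma> :: 'a::euclidean_space \<Rightarrow> real)"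
  unfolding gaussian_weight_def[abs_def]
  by (intro integrable_lborel_prod gaussian_fourier_real)

lemma gaussian_fourier:
  fixes x :: "'a::euclidean_space"
  assumes "\<sigma> > 0"
  shows "(\<integral>\<xi>. cis (x \<bullet> \<xi>) * of_real (gaussian_weight \<sigma> \<xi>) \<partial>lborel) = of_real (gaussian_kernel \<sigma> x)"
proof -
  have i: "integrable lborel (\<lambda>s. cis (t * s) * of_real (exp (- (\<sigma> * s)\<^sup>2 / 2)))" for t
    by (rule Bochner_Integration.integrable_bound[OF gaussian_fourier_real(1)[OF assms]])
       (auto simp: norm_mult)
  have "(\<integral>\<xi>. cis (x \<bullet> \<xi>) * of_real (gaussian_weight \<sigma> \<xi>) \<partial>lborel)
     = (\<integral>\<xi>. (\<Prod>b\<in>Basis. (\<lambda>s. cis ((x \<bullet> b) * s) * of_real (exp (- (\<sigma> * s)\<^sup>2 / 2))) (\<xi> \<bullet> b)) \<partial>lborel)"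
    by (simp add: gaussian_weight_def cis_inner prod.distrib)
  also have "\<dots> = (\<Prod>b\<in>Basis. of_real (2 * pi * normal_density 0 \<sigma> (x \<bullet> b)))"
    by (subst integrable_lborel_prod(2)) (use i gaussian_fourier_real(2)[OF assms] in auto)
  also have "\<dots> = of_real (gaussian_kernel \<sigma> x)" by (simp add: gaussian_kernel_def)
  finally show ?thesis .
qed

lemma gaussian_kernel_nn_integral:
  assumes "\<sigma> > 0"
  shows "(\<integral>\<^sup>+x. ennreal (gaussian_kernel \<sigma> x) \<partial>(lborel :: 'a::euclidean_space measure)) = ennreal ((2 * pi) ^ DIM('a))"
proof -
  have "(\<integral>\<^sup>+x. ennreal (gaussian_kernel \<sigma> x) \<partial>(lborel :: 'a measure))
      = (\<integral>\<^sup>+x. (\<Prod>b\<in>Basis. ennreal (2 * pi * normal_density 0 \<sigma> (x \<bullet> b))) \<partial>(lborel :: 'a measure))"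
    by (simp add: gaussian_kernel_def prod_ennreal)
  also have "\<dots> = (\<Prod>b\<in>(Basis::'a set). \<integral>\<^sup>+x. ennreal (2 * pi * normal_density 0 \<sigma> x) \<partial>lborel)"
    by (rule nn_integral_lborel_prod) auto
  also have "(\<integral>\<^sup>+x. ennreal (2 * pi * normal_density 0 \<sigma> x) \<partial>lborel) = ennreal (2 * pi)"
    using assms by (subst nn_integral_eq_integral) (auto intro!: integrable_normal_density)
  finally show ?thesis by (simp add: ennreal_power)
qed

text \<open>Translation invariance of the measure and evenness of the kernel. Both orders are given
  because Schur's test integrates out either variable.\<close>

lemma gaussian_kernel_nn_integral_shift:
  fixes v :: "'a::euclidean_space"
  assumes "\<sigma> > 0"
  shows "(\<integral>\<^sup>+x. ennreal (gaussian_kernel \<sigma> (v - x)) \<partial>lborel) = ennreal ((2 * pi) ^ DIM('a))"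
    and "(\<integral>\<^sup>+x. ennreal (gaussian_kernel \<sigma> (x - v)) \<partial>lborel) = ennreal ((2 * pi) ^ DIM('a))"
proof -
  have even: "gaussian_kernel \<sigma> (v - x) = gaussian_kernel \<sigma> (x - v)" for x
    by (simp add: gaussian_kernel_def normal_density_def inner_diff_left power2_commute)
  have "(\<integral>\<^sup>+x. ennreal (gaussian_kernel \<sigma> x) \<partial>(lborel :: 'a measure))
      = (\<integral>\<^sup>+x. ennreal (gaussian_kernel \<sigma> x) \<partial>(distr lborel borel ((+) (- v))))"
    by (simp add: lborel_distr_plus)
  also have "\<dots> = (\<integral>\<^sup>+x. ennreal (gaussian_kernel \<sigma> (x - v)) \<partial>lborel)"
    by (subst nn_integral_distr) auto
  finally show "(\<integral>\<^sup>+x. ennreal (gaussian_kernel \<sigma> (x - v)) \<partial>lborel) = ennreal ((2 * pi) ^ DIM('a))"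
    by (simp add: gaussian_kernel_nn_integral[OF assms])
  then show "(\<integral>\<^sup>+x. ennreal (gaussian_kernel \<sigma> (v - x)) \<partial>lborel) = ennreal ((2 * pi) ^ DIM('a))"
    by (simp add: even)
qed

section \<open>The weighted double integral and the Plancherel inequality\<close>

lemma integrable_lborel_pair_mult:
  fixes f :: "'a::euclidean_space \<Rightarrow> 'c::{real_normed_field,banach,second_countable_topology}"
    and g :: "'b::euclidean_space \<Rightarrow> 'c"
  assumes "integrable lborel f" "integrable lborel g"
  shows "integrable lborel (\<lambda>p. f (fst p) * g (snd p))"
proof -
  have [measurable]: "f \<in> borel_measurable borel" "g \<in> borel_measurable borel"
    using assms by auto
  show ?thesis
    unfolding lborel_prod[symmetric]
    using assms by (intro lborel_pair.Fubini_integrable) (auto simp: norm_mult)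
qed

text \<open>The squared modulus of the transform is a double integral over u and v. The weight makes
  the triple integral absolutely convergent, so \<xi> may be integrated out first, which leaves the
  Gaussian kernel at v - u.\<close>

lemma sqnorm_fourier_L1_gaussian_weight:
  fixes f :: "'a::euclidean_space \<Rightarrow> complex"
  assumes f: "integrable lborel f" and \<sigma>: "\<sigma> > 0"
  shows "of_real (\<integral>\<xi>. (norm (fourier_L1 f \<xi>))\<^sup>2 * gaussian_weight \<sigma> \<xi> \<partial>lborel)
    = (\<integral>p. f (fst p) * cnj (f (snd p)) * of_real (gaussian_kernel \<sigma> (snd p - fst p)) \<partial>(lborel :: ('a \<times> 'a) measure))"
proof -
  have [measurable]: "f \<in> borel_measurable borel" using f by auto
  define h where "h \<xi> p = of_real (gaussian_weight \<sigma> \<xi>) *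
      ((cis (- (fst p \<bullet> \<xi>)) * f (fst p)) * cnj (cis (- (snd p \<bullet> \<xi>)) * f (snd p)))"
    for \<xi> and p :: "'a \<times> 'a"
  have w: "integrable lborel (\<lambda>\<xi>::'a. complex_of_real (gaussian_weight \<sigma> \<xi>))"
    by (intro integrable_of_real gaussian_weight_integrable \<sigma>)
  have ff: "integrable lborel (\<lambda>p. f (fst p) * cnj (f (snd p)))"
    using f by (intro integrable_lborel_pair_mult) auto
  \<comment> \<open>Absolute convergence: the modulus of \<open>h\<close> is the product of the
    weight with |f(u)| |f(v)|.\<close>
  have "integrable lborel (case_prod h)"
  proof (rule Bochner_Integration.integrable_bound[OF integrable_lborel_pair_mult[OF w ff]])
    show "case_prod h \<in> borel_measurable lborel"
      unfolding h_def measurable_lborel2 borel_prod[symmetric] by measurable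
  qed (auto simp: h_def norm_mult)
  then have int: "integrable (lborel \<Otimes>\<^sub>M lborel) (case_prod h)"
    by (simp add: lborel_prod)
  have osc: "integrable lborel (\<lambda>u. cis (- (u \<bullet> \<xi>)) * f u)" for \<xi>
    by (rule Bochner_Integration.integrable_bound[OF f]) (auto simp: norm_mult)
  have inner: "(\<integral>p. h \<xi> p \<partial>lborel) = of_real ((norm (fourier_L1 f \<xi>))\<^sup>2 * gaussian_weight \<sigma> \<xi>)" for \<xi>
  proof -
    have "(\<integral>p. (cis (- (fst p \<bullet> \<xi>)) * f (fst p)) * cnj (cis (- (snd p \<bullet> \<xi>)) * f (snd p)) \<partial>(lborel :: ('a \<times> 'a) measure))
       = (\<integral>u. (\<integral>v. (cis (- (u \<bullet> \<xi>)) * f u) * cnj (cis (- (v \<bullet> \<xi>)) * f v) \<partial>lborel) \<partial>lborel)"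
      unfolding lborel_prod[symmetric]
      by (subst lborel_pair.integral_fst'[symmetric])
        (use integrable_lborel_pair_mult[OF osc integrable_cnj[OF osc], of \<xi> \<xi>] in \<open>auto simp: lborel_prod\<close>)
    also have "\<dots> = (\<integral>u. (cis (- (u \<bullet> \<xi>)) * f u) * cnj (fourier_L1 f \<xi>) \<partial>lborel)"
      by (simp add: fourier_L1_def del: complex_cnj_mult)
    also have "\<dots> = fourier_L1 f \<xi> * cnj (fourier_L1 f \<xi>)"
      by (simp add: fourier_L1_def)
    also have "\<dots> = of_real ((norm (fourier_L1 f \<xi>))\<^sup>2)"
      by (rule complex_norm_square[symmetric])
    finally show ?thesis
      unfolding h_def by simp
  qed
  have kernel: "(\<integral>\<xi>. h \<xi> p \<partial>lborel) = f (fst p) * cnj (f (snd p)) * of_real (gaussian_kernel \<sigma> (snd p - fst p))" for p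
  proof -
    have "h \<xi> p = f (fst p) * cnj (f (snd p)) * (cis ((snd p - fst p) \<bullet> \<xi>) * of_real (gaussian_weight \<sigma> \<xi>))" for \<xi>
    proof -
      have "cis (- (fst p \<bullet> \<xi>)) * cnj (cis (- (snd p \<bullet> \<xi>))) = cis ((snd p - fst p) \<bullet> \<xi>)"
        by (simp add: cis_cnj cis_mult inner_diff_left)
      then show ?thesis unfolding h_def by (simp add: mult_ac)
    qed
    then show ?thesis
      by (simp add: gaussian_fourier[OF \<sigma>])
  qed
  have "of_real (\<integral>\<xi>. (norm (fourier_L1 f \<xi>))\<^sup>2 * gaussian_weight \<sigma> \<xi> \<partial>lborel) = (\<integral>\<xi>. (\<integral>p. h \<xi> p \<partial>lborel) \<partial>lborel)"
    unfolding inner by (rule integral_complex_of_real[symmetric])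
  also have "\<dots> = (\<integral>p. (\<integral>\<xi>. h \<xi> p \<partial>lborel) \<partial>lborel)"
    using lborel_pair.Fubini_integral[OF int] by simp
  finally show ?thesis unfolding kernel .
qed

text \<open>Schur's test. By |a b| \<le> (a^2 + b^2) / 2 the integrand splits into two halves, each
  containing \<open>f\<close> at one variable only; the other variable integrates the kernel to
  \<open>C\<close>.\<close>

lemma nn_integral_symmetric_kernel_le:
  fixes f :: "'a::euclidean_space \<Rightarrow> complex" and k :: "'a \<Rightarrow> real"
  assumes [measurable]: "f \<in> borel_measurable borel" "k \<in> borel_measurable borel"
    and nonneg: "\<And>x. 0 \<le> k x"
    and C: "\<And>v. (\<integral>\<^sup>+x. ennreal (k (v - x)) \<partial>lborel) = C" "\<And>v. (\<integral>\<^sup>+x. ennreal (k (x - v)) \<partial>lborel) = C"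
  shows "(\<integral>\<^sup>+p. ennreal (norm (f (fst p) * cnj (f (snd p)) * of_real (k (snd p - fst p)))) \<partial>(lborel :: ('a \<times> 'a) measure))
    \<le> C * sqnorm_L2 f"
proof -
  have "(\<integral>\<^sup>+p. ennreal (norm (f (fst p) * cnj (f (snd p)) * of_real (k (snd p - fst p)))) \<partial>(lborel :: ('a \<times> 'a) measure))
    \<le> (\<integral>\<^sup>+p. ennreal ((norm (f (fst p)))\<^sup>2 / 2) * ennreal (k (snd p - fst p))
          + ennreal ((norm (f (snd p)))\<^sup>2 / 2) * ennreal (k (snd p - fst p)) \<partial>(lborel :: ('a \<times> 'a) measure))"
  proof (intro nn_integral_mono)
    fix p :: "'a \<times> 'a"
    have "norm (f (fst p)) * norm (f (snd p)) \<le> (norm (f (fst p)))\<^sup>2 / 2 + (norm (f (snd p)))\<^sup>2 / 2"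
      using sum_squares_bound[of "norm (f (fst p))" "norm (f (snd p))"] by simp
    then have "norm (f (fst p) * cnj (f (snd p)) * of_real (k (snd p - fst p)))
        \<le> ((norm (f (fst p)))\<^sup>2 / 2 + (norm (f (snd p)))\<^sup>2 / 2) * k (snd p - fst p)"
      using nonneg by (simp add: norm_mult mult_right_mono)
    then have "ennreal (norm (f (fst p) * cnj (f (snd p)) * of_real (k (snd p - fst p))))
        \<le> ennreal (((norm (f (fst p)))\<^sup>2 / 2 + (norm (f (snd p)))\<^sup>2 / 2) * k (snd p - fst p))"
      by (rule ennreal_leI)
    also have "\<dots> = ennreal ((norm (f (fst p)))\<^sup>2 / 2) * ennreal (k (snd p - fst p))
          + ennreal ((norm (f (snd p)))\<^sup>2 / 2) * ennreal (k (snd p - fst p))"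
      using nonneg by (simp add: ennreal_mult'[symmetric] ennreal_plus[symmetric] distrib_right del: ennreal_plus)
    finally show "ennreal (norm (f (fst p) * cnj (f (snd p)) * of_real (k (snd p - fst p)))) \<le> \<dots>" .
  qed
  also have "\<dots> = (\<integral>\<^sup>+p. ennreal ((norm (f (fst p)))\<^sup>2 / 2) * ennreal (k (snd p - fst p)) \<partial>(lborel :: ('a \<times> 'a) measure))
      + (\<integral>\<^sup>+p. ennreal ((norm (f (snd p)))\<^sup>2 / 2) * ennreal (k (snd p - fst p)) \<partial>(lborel :: ('a \<times> 'a) measure))"
    unfolding lborel_prod[symmetric] by (intro nn_integral_add) measurable
  also have "(\<integral>\<^sup>+p. ennreal ((norm (f (fst p)))\<^sup>2 / 2) * ennreal (k (snd p - fst p)) \<partial>(lborel :: ('a \<times> 'a) measure))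
      = (\<integral>\<^sup>+u. (\<integral>\<^sup>+v. ennreal ((norm (f u))\<^sup>2 / 2) * ennreal (k (v - u)) \<partial>lborel) \<partial>lborel)"
    unfolding lborel_prod[symmetric] by (subst lborel.nn_integral_fst[symmetric]) (auto simp: case_prod_beta')
  also have "\<dots> = (\<integral>\<^sup>+u. ennreal ((norm (f u))\<^sup>2 / 2) * C \<partial>lborel)"
    by (subst nn_integral_cmult) (auto simp: C)
  also have "(\<integral>\<^sup>+p. ennreal ((norm (f (snd p)))\<^sup>2 / 2) * ennreal (k (snd p - fst p)) \<partial>(lborel :: ('a \<times> 'a) measure))
      = (\<integral>\<^sup>+v. (\<integral>\<^sup>+u. ennreal ((norm (f v))\<^sup>2 / 2) * ennreal (k (v - u)) \<partial>lborel) \<partial>lborel)"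
    unfolding lborel_prod[symmetric] by (subst lborel_pair.nn_integral_snd[symmetric]) (auto simp: case_prod_beta')
  also have "\<dots> = (\<integral>\<^sup>+u. ennreal ((norm (f u))\<^sup>2 / 2) * C \<partial>lborel)"
    by (subst nn_integral_cmult) (auto simp: C)
  also have "(\<integral>\<^sup>+u. ennreal ((norm (f u))\<^sup>2 / 2) * C \<partial>lborel) + (\<integral>\<^sup>+u. ennreal ((norm (f u))\<^sup>2 / 2) * C \<partial>lborel)
      = (\<integral>\<^sup>+u. ennreal ((norm (f u))\<^sup>2 / 2) * C + ennreal ((norm (f u))\<^sup>2 / 2) * C \<partial>lborel)"
    by (intro nn_integral_add[symmetric]) measurable
  also have "\<dots> = (\<integral>\<^sup>+u. C * ennreal ((norm (f u))\<^sup>2) \<partial>lborel)"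
  proof (intro nn_integral_cong)
    fix u
    have "ennreal ((norm (f u))\<^sup>2 / 2) * C + ennreal ((norm (f u))\<^sup>2 / 2) * C
        = (ennreal ((norm (f u))\<^sup>2 / 2) + ennreal ((norm (f u))\<^sup>2 / 2)) * C"
      by (rule distrib_right[symmetric])
    also have "ennreal ((norm (f u))\<^sup>2 / 2) + ennreal ((norm (f u))\<^sup>2 / 2) = ennreal ((norm (f u))\<^sup>2)"
      by (subst ennreal_plus[symmetric]) auto
    finally show "ennreal ((norm (f u))\<^sup>2 / 2) * C + ennreal ((norm (f u))\<^sup>2 / 2) * C = C * ennreal ((norm (f u))\<^sup>2)"
      by (simp only: mult.commute)
  qed
  also have "\<dots> = C * sqnorm_L2 f"
    unfolding sqnorm_L2_def by (intro nn_integral_cmult) measurable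
  finally show ?thesis .
qed

text \<open>The double integral is a quadratic form in \<open>f\<close>, which Schur's test bounds
  by the mass of the Gaussian kernel. This mass is the same for all \<sigma>.\<close>

lemma sqnorm_fourier_L1_weighted_le:
  fixes f :: "'a::euclidean_space \<Rightarrow> complex"
  assumes f: "integrable lborel f" and \<sigma>: "\<sigma> > 0"
  shows "(\<integral>\<^sup>+\<xi>. ennreal ((norm (fourier_L1 f \<xi>))\<^sup>2 * gaussian_weight \<sigma> \<xi>) \<partial>lborel)
    \<le> ennreal ((2 * pi) ^ DIM('a)) * sqnorm_L2 f"
proof (cases "sqnorm_L2 f = \<infinity>")
  case True
  then show ?thesis by (simp add: ennreal_mult_top)
next
  case False
  have [measurable]: "f \<in> borel_measurable borel" using f by auto
  let ?I = "\<integral>\<xi>. (norm (fourier_L1 f \<xi>))\<^sup>2 * gaussian_weight \<sigma> \<xi> \<partial>lborel"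
  let ?g = "\<lambda>p. f (fst p) * cnj (f (snd p)) * of_real (gaussian_kernel \<sigma> (snd p - fst p))"
  have bound: "(\<integral>\<^sup>+p. ennreal (norm (?g p)) \<partial>lborel) \<le> ennreal ((2 * pi) ^ DIM('a)) * sqnorm_L2 f"
    using gaussian_kernel_nn_integral_shift[OF \<sigma>, where 'a='a]
    by (intro nn_integral_symmetric_kernel_le gaussian_nonneg) auto
  \<comment> \<open>The transform of an integrable function is bounded, so its weighted square is
    integrable and the two kinds of integral agree.\<close>
  have "norm (fourier_L1 f \<xi>) \<le> (\<integral>u. norm (f u) \<partial>lborel)" for \<xi>
    unfolding fourier_L1_def
    by (rule order_trans[OF integral_norm_bound]) (simp add: norm_mult)
  then have "(norm (fourier_L1 f \<xi>))\<^sup>2 \<le> (\<integral>u. norm (f u) \<partial>lborel)\<^sup>2" for \<xi>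
    by (intro power_mono) auto
  then have "integrable lborel (\<lambda>\<xi>. (norm (fourier_L1 f \<xi>))\<^sup>2 * gaussian_weight \<sigma> \<xi>)"
    by (intro Bochner_Integration.integrable_bound[OF integrable_mult_right[OF gaussian_weight_integrable[OF \<sigma>], of "(\<integral>u. norm (f u) \<partial>lborel)\<^sup>2"]])
       (auto simp: abs_mult gaussian_nonneg intro!: mult_right_mono)
  then have "(\<integral>\<^sup>+\<xi>. ennreal ((norm (fourier_L1 f \<xi>))\<^sup>2 * gaussian_weight \<sigma> \<xi>) \<partial>lborel) = ennreal ?I"
    by (intro nn_integral_eq_integral) (auto simp: gaussian_nonneg)
  \<comment> \<open>The detour through the complex modulus permits the double integral to be
    substituted and its modulus to be taken inside.\<close>
  also have "\<dots> \<le> ennreal (norm (complex_of_real ?I))"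
    by (intro ennreal_leI) simp
  also have "\<dots> = ennreal (norm (\<integral>p. ?g p \<partial>lborel))"
    by (subst sqnorm_fourier_L1_gaussian_weight[OF f \<sigma>]) simp
  also have "\<dots> \<le> (\<integral>\<^sup>+p. ennreal (norm (?g p)) \<partial>lborel)"
  proof (rule integral_norm_bound_ennreal)
    have "?g \<in> borel_measurable lborel"
      unfolding measurable_lborel2 borel_prod[symmetric] by measurable
    then show "integrable lborel ?g"
      unfolding integrable_iff_bounded
      using le_less_trans[OF bound, of \<infinity>] False
      by (auto simp: ennreal_mult_less_top less_top)
  qed
  also note bound
  finally show ?thesis .
qed

text \<open>As \<sigma> tends to 0 the weight tends to 1 while the bound stays fixed; Fatou's lemma
  carries the bound to the limit.\<close>

lemma sqnorm_fourier_L1_le: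
  fixes f :: "'a::euclidean_space \<Rightarrow> complex"
  assumes f: "integrable lborel f"
  shows "sqnorm_L2 (fourier_L1 f) \<le> ennreal ((2 * pi) ^ DIM('a)) * sqnorm_L2 f"
proof -
  have [measurable]: "f \<in> borel_measurable borel" using f by auto
  let ?s = "\<lambda>n::nat. inverse (real (Suc n))"
  let ?h = "\<lambda>n \<xi>. ennreal ((norm (fourier_L1 f \<xi>))\<^sup>2 * gaussian_weight (?s n) \<xi>)"
  have "(\<lambda>n. ?h n \<xi>) \<longlonglongrightarrow> ennreal ((norm (fourier_L1 f \<xi>))\<^sup>2)" for \<xi>
  proof -
    have "(\<lambda>n. (norm (fourier_L1 f \<xi>))\<^sup>2 * gaussian_weight (?s n) \<xi>)
        \<longlonglongrightarrow> (norm (fourier_L1 f \<xi>))\<^sup>2 * (\<Prod>b\<in>(Basis::'a set). exp (- (0 * (\<xi> \<bullet> b))\<^sup>2 / 2))"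
      unfolding gaussian_weight_def by (intro tendsto_intros LIMSEQ_inverse_real_of_nat) simp
    then show ?thesis by (intro tendsto_ennrealI) simp
  qed
  then have "liminf (\<lambda>n. ?h n \<xi>) = ennreal ((norm (fourier_L1 f \<xi>))\<^sup>2)" for \<xi>
    by (intro lim_imp_Liminf) auto
  then have "sqnorm_L2 (fourier_L1 f) = (\<integral>\<^sup>+\<xi>. liminf (\<lambda>n. ?h n \<xi>) \<partial>lborel)"
    unfolding sqnorm_L2_def by simp
  also have "\<dots> \<le> liminf (\<lambda>n. \<integral>\<^sup>+\<xi>. ?h n \<xi> \<partial>lborel)"
    by (intro nn_integral_liminf) measurable
  also have "\<dots> \<le> limsup (\<lambda>n. \<integral>\<^sup>+\<xi>. ?h n \<xi> \<partial>lborel)"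
    by (intro Liminf_le_Limsup) simp
  also have "\<dots> \<le> ennreal ((2 * pi) ^ DIM('a)) * sqnorm_L2 f"
    by (intro Limsup_bounded always_eventually allI sqnorm_fourier_L1_weighted_le f) simp
  finally show ?thesis .
qed

lemma sqnorm_fourier_L1_diff_le:
  fixes f g :: "'a::euclidean_space \<Rightarrow> complex"
  assumes "integrable lborel f" "integrable lborel g"
  shows "sqnorm_L2 (\<lambda>\<xi>. fourier_L1 f \<xi> - fourier_L1 g \<xi>)
    \<le> ennreal ((2 * pi) ^ DIM('a)) * sqnorm_L2 (\<lambda>u. f u - g u)"
  using sqnorm_fourier_L1_le[OF Bochner_Integration.integrable_diff[OF assms]]
  by (simp only: sqnorm_L2_def fourier_L1_diff[OF assms])

section \<open>The Fourier transform on square-integrable functions\<close>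

text \<open>Two sequences approximating \<open>f\<close> approach each other, hence so do their
  transforms by the Plancherel inequality. The chain \<open>g\<close>,
  \<open>fourier_L1 (F n)\<close>, \<open>fourier_L1 (G n)\<close>, \<open>g'\<close> therefore has
  steps tending to 0.\<close>

lemma is_fourier_L2_unique_AE:
  fixes f :: "'a::euclidean_space \<Rightarrow> complex"
  assumes "is_fourier_L2 f g" "is_fourier_L2 f g'"
  shows "AE u in lborel. g u = g' u"
proof -
  from assms obtain F G where
    F: "\<And>n. integrable lborel (F n)" "\<And>n. F n \<in> L2C" "L2_tendsto F f" "L2_tendsto (\<lambda>n. fourier_L1 (F n)) g" and
    G: "\<And>n. integrable lborel (G n)" "\<And>n. G n \<in> L2C" "L2_tendsto G f" "L2_tendsto (\<lambda>n. fourier_L1 (G n)) g'"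
    and L2: "f \<in> L2C" "g \<in> L2C" "g' \<in> L2C"
    unfolding is_fourier_L2_def by blast
  have [measurable]: "f \<in> borel_measurable borel" "g \<in> borel_measurable borel" "g' \<in> borel_measurable borel"
    "\<And>n. F n \<in> borel_measurable borel" "\<And>n. G n \<in> borel_measurable borel"
    using L2 F(2) G(2) by (auto simp: L2C_iff)
  let ?C = "ennreal ((2 * pi) ^ DIM('a))"
  let ?a = "\<lambda>n. sqnorm_L2 (\<lambda>u. fourier_L1 (F n) u - g u)"
  let ?b = "\<lambda>n. sqnorm_L2 (\<lambda>u. F n u - f u)"
  let ?c = "\<lambda>n. sqnorm_L2 (\<lambda>u. G n u - f u)"
  let ?d = "\<lambda>n. sqnorm_L2 (\<lambda>u. fourier_L1 (G n) u - g' u)"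
  have le: "sqnorm_L2 (\<lambda>u. g u - g' u) \<le> 2 * ?a n + 2 * (2 * (?C * (2 * ?b n + 2 * ?c n)) + 2 * ?d n)" for n
  proof -
    have "sqnorm_L2 (\<lambda>u. g u - g' u) \<le> 2 * sqnorm_L2 (\<lambda>u. g u - fourier_L1 (F n) u)
        + 2 * sqnorm_L2 (\<lambda>u. fourier_L1 (F n) u - g' u)"
      by (intro sqnorm_L2_triangle) measurable
    also have "sqnorm_L2 (\<lambda>u. fourier_L1 (F n) u - g' u) \<le>
        2 * sqnorm_L2 (\<lambda>u. fourier_L1 (F n) u - fourier_L1 (G n) u) + 2 * ?d n"
      by (intro sqnorm_L2_triangle) measurable
    also have "sqnorm_L2 (\<lambda>u. fourier_L1 (F n) u - fourier_L1 (G n) u) \<le> ?C * sqnorm_L2 (\<lambda>u. F n u - G n u)"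
      by (intro sqnorm_fourier_L1_diff_le F G)
    also have "sqnorm_L2 (\<lambda>u. F n u - G n u) \<le> 2 * ?b n + 2 * sqnorm_L2 (\<lambda>u. f u - G n u)"
      by (intro sqnorm_L2_triangle) measurable
    finally show ?thesis
      unfolding sqnorm_L2_diff_commute[of g "fourier_L1 (F n)"] sqnorm_L2_diff_commute[of f "G n"]
      by (simp add: mult_left_mono add_mono)
  qed
  have lim: "?a \<longlonglongrightarrow> 0" "?b \<longlonglongrightarrow> 0" "?c \<longlonglongrightarrow> 0" "?d \<longlonglongrightarrow> 0"
    using F G by (simp_all add: L2_tendsto_iff)
  have "(\<lambda>n. 2 * ?a n + 2 * (2 * (?C * (2 * ?b n + 2 * ?c n)) + 2 * ?d n))
      \<longlonglongrightarrow> 2 * 0 + 2 * (2 * (?C * (2 * 0 + 2 * 0)) + 2 * 0)"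
    by (intro tendsto_add ennreal_tendsto_cmult lim) auto
  then have "sqnorm_L2 (\<lambda>u. g u - g' u) \<le> 2 * 0 + 2 * (2 * (?C * (2 * 0 + 2 * 0)) + 2 * 0)"
    by (rule LIMSEQ_le_const) (intro exI[of _ 0] allI impI le)
  then have "(\<integral>\<^sup>+u. ennreal ((norm (g u - g' u))\<^sup>2) \<partial>lborel) = 0"
    by (simp add: sqnorm_L2_def)
  then have "AE u in lborel. ennreal ((norm (g u - g' u))\<^sup>2) = 0"
    by (subst (asm) nn_integral_0_iff_AE) auto
  then show ?thesis by eventually_elim simp
qed

text \<open>The transforms are Cauchy in mean square by the Plancherel inequality, and Fatou's lemma
  replaces one index of the Cauchy estimate by the pointwise limit \<open>g\<close>. Square
  integrability of \<open>g\<close> is a consequence.\<close>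

lemma is_fourier_L2_pointwise_limit:
  fixes f :: "'a::euclidean_space \<Rightarrow> complex"
  assumes F: "\<And>n. integrable lborel (F n)" "\<And>n. F n \<in> L2C" and f: "f \<in> L2C" "L2_tendsto F f"
    and g[measurable]: "g \<in> borel_measurable borel"
    and lim: "AE u in lborel. (\<lambda>n. fourier_L1 (F n) u) \<longlonglongrightarrow> g u"
  shows "is_fourier_L2 f g"
proof -
  have [measurable]: "f \<in> borel_measurable borel" "\<And>n. F n \<in> borel_measurable borel"
    using f F(2) by (auto simp: L2C_iff)
  let ?C = "ennreal ((2 * pi) ^ DIM('a))"
  let ?b = "\<lambda>n. sqnorm_L2 (\<lambda>u. F n u - f u)"
  have b: "?b \<longlonglongrightarrow> 0" using f by (simp add: L2_tendsto_iff)
  have le: "sqnorm_L2 (\<lambda>u. fourier_L1 (F n) u - g u) \<le> ?C * (2 * ?b n)" for n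
  proof -
    \<comment> \<open>Here \<open>n\<close> is fixed and \<open>m\<close> tends to infinity: the
      error of \<open>F m\<close> drops out and that of \<open>F n\<close> remains.\<close>
    let ?h = "\<lambda>m u. ennreal ((norm (fourier_L1 (F n) u - fourier_L1 (F m) u))\<^sup>2)"
    have "AE u in lborel. ennreal ((norm (fourier_L1 (F n) u - g u))\<^sup>2) = liminf (\<lambda>m. ?h m u)"
      using lim
    proof eventually_elim
      case (elim u)
      then have "(\<lambda>m. ?h m u) \<longlonglongrightarrow> ennreal ((norm (fourier_L1 (F n) u - g u))\<^sup>2)"
        by (intro tendsto_ennrealI tendsto_intros)
      then show ?case by (rule lim_imp_Liminf[OF trivial_limit_sequentially, symmetric])
    qed
    then have "sqnorm_L2 (\<lambda>u. fourier_L1 (F n) u - g u) = (\<integral>\<^sup>+u. liminf (\<lambda>m. ?h m u) \<partial>lborel)"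
      unfolding sqnorm_L2_def by (rule nn_integral_cong_AE)
    also have "\<dots> \<le> liminf (\<lambda>m. \<integral>\<^sup>+u. ?h m u \<partial>lborel)"
      by (intro nn_integral_liminf) measurable
    also have "\<dots> \<le> liminf (\<lambda>m. ?C * (2 * ?b n + 2 * ?b m))"
    proof (intro Liminf_mono always_eventually allI)
      fix m
      have "(\<integral>\<^sup>+u. ?h m u \<partial>lborel) \<le> ?C * sqnorm_L2 (\<lambda>u. F n u - F m u)"
        using sqnorm_fourier_L1_diff_le[OF F(1) F(1), of n m] by (simp add: sqnorm_L2_def)
      also have "sqnorm_L2 (\<lambda>u. F n u - F m u) \<le> 2 * ?b n + 2 * sqnorm_L2 (\<lambda>u. f u - F m u)"
        by (intro sqnorm_L2_triangle) measurable
      also have "sqnorm_L2 (\<lambda>u. f u - F m u) = ?b m"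
        by (rule sqnorm_L2_diff_commute)
      finally show "(\<integral>\<^sup>+u. ?h m u \<partial>lborel) \<le> ?C * (2 * ?b n + 2 * ?b m)"
        by (simp add: mult_left_mono)
    qed
    also have "\<dots> = ?C * (2 * ?b n + 2 * 0)"
    proof (rule lim_imp_Liminf[OF trivial_limit_sequentially])
      show "(\<lambda>m. ?C * (2 * ?b n + 2 * ?b m)) \<longlonglongrightarrow> ?C * (2 * ?b n + 2 * 0)"
        by (rule ennreal_tendsto_cmult[OF _ tendsto_add[OF tendsto_const ennreal_tendsto_cmult[OF _ b]]]) auto
    qed
    finally show ?thesis by simp
  qed
  have "(\<lambda>n. ?C * (2 * ?b n)) \<longlonglongrightarrow> ?C * (2 * 0)"
    by (intro ennreal_tendsto_cmult b) auto
  then have bound: "(\<lambda>n. ?C * (2 * ?b n)) \<longlonglongrightarrow> 0" by simp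
  have conv: "L2_tendsto (\<lambda>n. fourier_L1 (F n)) g"
    unfolding L2_tendsto_iff
  proof (rule tendsto_sandwich[OF _ _ tendsto_const bound])
    show "\<forall>\<^sub>F n in sequentially. 0 \<le> sqnorm_L2 (\<lambda>u. fourier_L1 (F n) u - g u)" by simp
    show "\<forall>\<^sub>F n in sequentially. sqnorm_L2 (\<lambda>u. fourier_L1 (F n) u - g u) \<le> ?C * (2 * ?b n)"
      by (intro always_eventually allI le)
  qed
  have fin: "sqnorm_L2 (\<lambda>u. h u - k u) < \<infinity>" if "h \<in> L2C" "k \<in> L2C" for h k :: "'a \<Rightarrow> complex"
  proof -
    have "sqnorm_L2 (\<lambda>u. h u - k u) \<le> 2 * sqnorm_L2 (\<lambda>u. h u - 0) + 2 * sqnorm_L2 (\<lambda>u. k u - 0)"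
      using that sqnorm_L2_triangle[of h "\<lambda>_. 0" k]
      by (simp only: L2C_iff sqnorm_L2_diff_commute[of "\<lambda>_. 0"]) simp
    also have "\<dots> < \<infinity>"
      using that by (simp add: L2C_iff ennreal_mult_less_top)
    finally show ?thesis .
  qed
  have "?C * (2 * ?b 0) < \<infinity>"
    using fin[OF F(2) f(1), of 0] by (simp add: ennreal_mult_less_top)
  then have 1: "sqnorm_L2 (\<lambda>u. fourier_L1 (F 0) u - g u) < \<infinity>"
    using le[of 0] by (rule le_less_trans[rotated])
  have 2: "sqnorm_L2 (fourier_L1 (F 0)) < \<infinity>"
    by (rule le_less_trans[OF sqnorm_fourier_L1_le[OF F(1)]])
       (use F(2)[of 0] in \<open>simp add: L2C_iff ennreal_mult_less_top\<close>)
  \<comment> \<open>\<open>g\<close> lies at finite distance from the transform of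
    \<open>F 0\<close>, whose norm is finite by the Plancherel inequality.\<close>
  have "sqnorm_L2 (\<lambda>u. g u - 0) \<le> 2 * sqnorm_L2 (\<lambda>u. g u - fourier_L1 (F 0) u)
      + 2 * sqnorm_L2 (\<lambda>u. fourier_L1 (F 0) u - 0)"
    by (intro sqnorm_L2_triangle) measurable
  also have "\<dots> < \<infinity>"
    using 1 2 unfolding sqnorm_L2_diff_commute[of g "fourier_L1 (F 0)"] by (simp add: ennreal_mult_less_top)
  finally have "g \<in> L2C" by (simp add: L2C_iff)
  then show ?thesis
    unfolding is_fourier_L2_def using conv F f by (intro conjI exI[of _ F]) auto
qed

text \<open>The representative picked by \<open>SOME\<close> is a transform once one exists, and
  uniqueness then identifies it almost everywhere with any computed one.\<close>

lemma fourier_L2_AE_eq: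
  assumes "is_fourier_L2 f g"
  shows "fourier_L2 f \<in> L2C" "AE u in lborel. fourier_L2 f u = g u"
proof -
  have *: "is_fourier_L2 f (fourier_L2 f)"
    unfolding fourier_L2_def by (rule someI[of "is_fourier_L2 f" g]) (rule assms)
  then show "fourier_L2 f \<in> L2C" by (simp add: is_fourier_L2_def)
  show "AE u in lborel. fourier_L2 f u = g u"
    by (rule is_fourier_L2_unique_AE[OF * assms])
qed

section \<open>The one-dimensional kernels\<close>

text \<open>Carries the power integrals over (0,1] and [1,\<infinity>), known as gauge integrals,
  over to Lebesgue integrability; for nonnegative functions the two agree.\<close>

lemma integrable_lborel_has_integral_nonneg:
  fixes f :: "real \<Rightarrow> real"
  assumes [measurable]: "f \<in> borel_measurable borel" "S \<in> sets borel"
    and "\<And>x. 0 \<le> f x" and "(f has_integral I) S"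
  shows "integrable lborel (\<lambda>x. indicator S x * f x)"
proof -
  have "((\<lambda>x. indicator S x * f x) has_integral I) UNIV"
  proof -
    have "(\<lambda>x. indicator S x * f x) = (\<lambda>x. if x \<in> S then f x else 0)"
      by (auto simp: indicator_def)
    then show ?thesis using assms(4) by (simp only: has_integral_restrict_UNIV)
  qed
  then have "(\<integral>\<^sup>+x. ennreal (indicator S x * f x) \<partial>lborel) = ennreal I"
    using assms(3) by (intro nn_integral_has_integral_lborel) auto
  then show ?thesis
    using assms(3) by (intro integrableI_bounded) (auto simp: abs_mult)
qed

lemma one_minus_cos_le: "1 - cos x \<le> x\<^sup>2 / 2" for x :: real
proof -
  have "\<bar>sin (x / 2)\<bar> \<le> \<bar>x / 2\<bar>" by (rule abs_sin_x_le_abs_x)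
  then have "(sin (x / 2))\<^sup>2 \<le> (x / 2)\<^sup>2" by (rule abs_le_square_iff[THEN iffD1])
  moreover have "cos x = 1 - 2 * (sin (x / 2))\<^sup>2"
    using cos_double_sin[of "x / 2"] by simp
  ultimately show ?thesis by (simp add: power_divide)
qed

text \<open>Near 0 the numerator is at most a multiple of x^2, which calls for \<beta> < 3; far out
  it is at most 2, which calls for \<beta> > 1.\<close>

lemma integrable_one_minus_cos:
  fixes a \<beta> :: real
  assumes "1 < \<beta>" "\<beta> < 3"
  shows "integrable lborel (\<lambda>x. (1 - cos (a * x)) / \<bar>x\<bar> powr \<beta>)"
proof -
  let ?g = "\<lambda>x. (1 - cos (a * x)) / \<bar>x\<bar> powr \<beta>"
  let ?w = "\<lambda>x::real. a\<^sup>2 / 2 * (indicator {0..1} x * x powr (2 - \<beta>)) + 2 * (indicator {1..} x * x powr (- \<beta>))"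
  have w: "integrable lborel ?w"
    using assms has_integral_powr_from_0[of "2 - \<beta>" 1] has_integral_powr_to_inf[of "- \<beta>" 1]
    by (intro Bochner_Integration.integrable_add integrable_mult_right integrable_lborel_has_integral_nonneg) auto
  have le: "indicator {0..} x * ?g x \<le> ?w x" for x :: real
  proof (cases "x \<le> 0")
    case True
    then show ?thesis by (cases "x = 0") (auto simp: indicator_def)
  next
    case False
    then have x: "x > 0" by simp
    show ?thesis
    proof (cases "x \<le> 1")
      case True
      have "?g x = (1 - cos (a * x)) / x powr \<beta>"
        using x by simp
      also have "\<dots> \<le> (a * x)\<^sup>2 / 2 / x powr \<beta>"
        by (intro divide_right_mono one_minus_cos_le) simp
      also have "\<dots> = a\<^sup>2 / 2 * x powr (2 - \<beta>)"
        using x by (simp add: powr_diff power_mult_distrib)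
      also have "\<dots> \<le> ?w x" using x True by (auto simp: indicator_def)
      finally show ?thesis using x by simp
    next
      case False
      have "1 - cos (a * x) \<le> 2" using cos_ge_minus_one[of "a * x"] by linarith
      then have "?g x \<le> 2 / x powr \<beta>" using x by (simp add: divide_right_mono)
      then show ?thesis using x False by (simp add: powr_minus_divide)
    qed
  qed
  have "integrable lborel (\<lambda>x. indicator {0..} x *\<^sub>R ?g x)"
    using le by (intro Bochner_Integration.integrable_bound[OF w])
      (auto simp: abs_mult intro: order_trans[OF _ abs_ge_self])
  \<comment> \<open>The integrand is even, so the positive half-line decides.\<close>
  then have "has_bochner_integral lborel ?g (2 *\<^sub>R (\<integral>x. indicator {0..} x *\<^sub>R ?g x \<partial>lborel))"
    by (intro has_bochner_integral_even_function has_bochner_integral_integrable) auto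
  then show ?thesis by (simp add: has_bochner_integral_iff)
qed

definition cos_moment :: "real \<Rightarrow> real" where
  "cos_moment \<beta> = (\<integral>x. (1 - cos x) / \<bar>x\<bar> powr \<beta> \<partial>lborel)"

text \<open>The integrand is nonnegative, and on [1,2], a set of positive measure, it is strictly
  positive because cos x < 1 there.\<close>

lemma cos_moment_pos:
  assumes "1 < \<beta>" "\<beta> < 3"
  shows "0 < cos_moment \<beta>"
proof -
  let ?g = "\<lambda>x. (1 - cos x) / \<bar>x\<bar> powr \<beta>"
  have int: "integrable lborel ?g" using integrable_one_minus_cos[OF assms, of 1] by simp
  have "cos_moment \<beta> \<noteq> 0"
  proof
    assume "cos_moment \<beta> = 0"
    then have "AE x in lborel. ?g x = 0"
      unfolding cos_moment_def using int by (subst (asm) integral_nonneg_eq_0_iff_AE) auto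
    then have "AE x in lborel. x \<notin> {1..2::real}"
    proof eventually_elim
      case (elim x)
      show ?case
      proof
        assume "x \<in> {1..2}"
        then have "cos x < cos 0"
          using pi_gt3 by (intro cos_monotone_0_pi) auto
        then show False using elim \<open>x \<in> {1..2}\<close> by auto
      qed
    qed
    then have "{1..2::real} \<in> null_sets lborel"
      by (subst AE_iff_null_sets) auto
    then show False by (simp add: null_sets_def)
  qed
  moreover have "0 \<le> cos_moment \<beta>"
    unfolding cos_moment_def by (intro integral_nonneg_AE) auto
  ultimately show ?thesis by simp
qed

text \<open>Scaling x \<mapsto> x / a. For a = 0 both sides vanish, by
  \<open>0 powr s = 0\<close>.\<close>

lemma integral_one_minus_cos:
  assumes "1 < \<beta>"
  shows "(\<integral>x. (1 - cos (a * x)) / \<bar>x\<bar> powr \<beta> \<partial>lborel) = \<bar>a\<bar> powr (\<beta> - 1) * cos_moment \<beta>"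
proof (cases "a = 0")
  case False
  have "(\<integral>x. (1 - cos (a * x)) / \<bar>x\<bar> powr \<beta> \<partial>lborel)
      = \<bar>1 / a\<bar> * (\<integral>x. (1 - cos x) / \<bar>x / a\<bar> powr \<beta> \<partial>lborel)"
    using False by (subst lborel_integral_real_affine[of "1 / a" _ 0]) simp_all
  also have "(\<lambda>x. (1 - cos x) / \<bar>x / a\<bar> powr \<beta>) = (\<lambda>x. \<bar>a\<bar> powr \<beta> * ((1 - cos x) / \<bar>x\<bar> powr \<beta>))"
    using False by (auto simp: fun_eq_iff abs_divide powr_divide)
  also have "\<bar>1 / a\<bar> * (\<integral>x. \<bar>a\<bar> powr \<beta> * ((1 - cos x) / \<bar>x\<bar> powr \<beta>) \<partial>lborel)
      = \<bar>1 / a\<bar> * (\<bar>a\<bar> powr \<beta> * cos_moment \<beta>)"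
    by (simp only: integral_mult_right_zero cos_moment_def)
  finally show ?thesis
    using False by (simp add: powr_diff)
qed auto

text \<open>The truncation avoids both singular ends of the kernels, so truncated kernels are bounded with
  compact support.\<close>

definition band :: "nat \<Rightarrow> real set" where
  "band n = {x. inverse (real (Suc n)) \<le> \<bar>x\<bar> \<and> \<bar>x\<bar> \<le> real (Suc n)}"

lemma compact_band: "compact (band n)"
proof -
  have "closed (band n)"
    unfolding band_def by (intro closed_Collect_conj closed_Collect_le continuous_intros)
  moreover have "band n \<subseteq> cball 0 (real (Suc n))"
    by (auto simp: band_def)
  ultimately show ?thesis
    using bounded_cball bounded_subset compact_eq_bounded_closed by blast
qed

lemma measurable_band [measurable]: "band n \<in> sets borel"
  using compact_band by (rule borel_compact)

lemma zero_notin_band: "0 \<notin> band n"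
  by (simp add: band_def not_le)

lemma minus_mem_band [simp]: "- x \<in> band n \<longleftrightarrow> x \<in> band n"
  by (simp add: band_def)

lemma eventually_mem_band:
  assumes "x \<noteq> 0"
  shows "\<forall>\<^sub>F n in sequentially. x \<in> band n"
proof -
  have "\<forall>\<^sub>F n in sequentially. inverse (real (Suc n)) < \<bar>x\<bar>"
    using assms by (intro order_tendstoD[OF LIMSEQ_inverse_real_of_nat]) simp
  moreover have "\<forall>\<^sub>F n in sequentially. \<bar>x\<bar> \<le> real n"
    using filterlim_real_sequentially by (simp add: filterlim_at_top)
  ultimately show ?thesis
    by eventually_elim (auto simp: band_def)
qed

text \<open>No band contains 0, so the truncated value at 0 is always 0, whence the hypothesis; any
  other point lies in all but finitely many bands. The kernels satisfy the hypothesis because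
  division by 0 gives 0.\<close>

lemma tendsto_indicator_band:
  fixes f :: "real \<Rightarrow> 'a::real_normed_algebra_1"
  assumes "f 0 = 0"
  shows "(\<lambda>n. indicator (band n) x * f x) \<longlonglongrightarrow> f x"
proof (cases "x = 0")
  case False
  have "\<forall>\<^sub>F n in sequentially. indicator (band n) x * f x = f x"
    using eventually_mem_band[OF False] by eventually_elim simp
  then show ?thesis by (rule tendsto_eventually)
qed (simp add: assms)

lemma integrable_band:
  fixes f :: "real \<Rightarrow> 'a::{real_normed_algebra_1,banach,second_countable_topology}"
  assumes "continuous_on (band n) f"
  shows "integrable lborel (\<lambda>x. indicator (band n) x * f x)"
proof -
  have "(\<lambda>x. indicator (band n) x * f x) = (\<lambda>x. indicator (band n) x *\<^sub>R f x)"
    by (auto simp: indicator_def)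
  then show ?thesis
    using borel_integrable_compact[OF compact_band assms] by simp
qed

section \<open>Limits of truncated cosine integrals\<close>

lemma band_one_minus_cos_tendsto:
  assumes "1 < \<beta>" "\<beta> < 3"
  shows "(\<lambda>n. \<integral>x. indicator (band n) x * ((1 - cos (a * x)) / \<bar>x\<bar> powr \<beta>) \<partial>lborel)
    \<longlonglongrightarrow> \<bar>a\<bar> powr (\<beta> - 1) * cos_moment \<beta>"
  unfolding integral_one_minus_cos[OF assms(1), symmetric]
proof (rule integral_dominated_convergence)
  show "integrable lborel (\<lambda>x. (1 - cos (a * x)) / \<bar>x\<bar> powr \<beta>)"
    by (rule integrable_one_minus_cos[OF assms])
  show "AE x in lborel. (\<lambda>n. indicator (band n) x * ((1 - cos (a * x)) / \<bar>x\<bar> powr \<beta>))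
      \<longlonglongrightarrow> (1 - cos (a * x)) / \<bar>x\<bar> powr \<beta>"
    by (intro AE_I2 tendsto_indicator_band) simp
qed (auto simp: indicator_def)

lemma band_cos_integrable: "integrable lborel (\<lambda>x. indicator (band n) x * (cos (a * x) / \<bar>x\<bar> powr \<alpha>))"
  using zero_notin_band by (intro integrable_band continuous_intros) auto

lemma band_one_minus_cos_integrable:
  "integrable lborel (\<lambda>x. indicator (band n) x * ((1 - cos (a * x)) / \<bar>x\<bar> powr \<alpha>))"
  using zero_notin_band by (intro integrable_band continuous_intros) auto

text \<open>For \<open>\<alpha> < 1\<close> the limit integral converges only conditionally; two integrations by parts
  turn it into an absolutely convergent one with exponent \<open>\<alpha> + 2\<close>.\<close>

lemma band_cos_by_parts:
  fixes a \<alpha> :: real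
  assumes "a \<noteq> 0"
  defines "F \<equiv> \<lambda>x. sin (a * x) / a * x powr (- \<alpha>) + \<alpha> / a\<^sup>2 * (1 - cos (a * x)) * x powr (- \<alpha> - 1)"
  shows "(\<integral>x. indicator (band n) x * (cos (a * x) / \<bar>x\<bar> powr \<alpha>) \<partial>lborel)
    = \<alpha> * (\<alpha> + 1) / a\<^sup>2 * (\<integral>x. indicator (band n) x * ((1 - cos (a * x)) / \<bar>x\<bar> powr (\<alpha> + 2)) \<partial>lborel)
      + 2 * (F (real (Suc n)) - F (inverse (real (Suc n))))"
proof -
  let ?l = "inverse (real (Suc n))" and ?r = "real (Suc n)"
  \<comment> \<open>\<open>F\<close> is an antiderivative of \<open>f\<close> on the positive
    half-line and collects the boundary terms of both integrations by parts. In the second one, sin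
    (a x) is integrated to (1 - cos (a x)) / a, which vanishes to second order at 0.\<close>
  define f where "f = (\<lambda>x. cos (a * x) / \<bar>x\<bar> powr \<alpha> - \<alpha> * (\<alpha> + 1) / a\<^sup>2 * ((1 - cos (a * x)) / \<bar>x\<bar> powr (\<alpha> + 2)))"
  have l: "0 < ?l" "?l \<le> ?r" by (auto simp: inverse_le_1_iff order_trans[of _ 1])
  have der: "(F has_vector_derivative f x) (at x within {?l..?r})" if "?l \<le> x" for x
  proof -
    have x: "x > 0" using that l by linarith
    have p1: "x powr (s - 1) = x powr s / x" for s
      using x by (simp add: powr_diff)
    have p2: "x powr (\<alpha> + 2) = x powr \<alpha> * x\<^sup>2"
      using x by (simp add: powr_add)
    have "((\<lambda>x. p * (sin (a * x) * x powr (- \<alpha>)) + q * ((1 - cos (a * x)) * x powr (- \<alpha> - 1))) has_real_derivative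
       p * (a * cos (a * x) * x powr (- \<alpha>) - \<alpha> * sin (a * x) * x powr (- \<alpha> - 1))
       + q * (a * sin (a * x) * x powr (- \<alpha> - 1) - (\<alpha> + 1) * (1 - cos (a * x)) * x powr (- \<alpha> - 1 - 1))) (at x)" for p q
      using x by (auto intro!: derivative_eq_intros simp: algebra_simps)
    note this[of "1 / a" "\<alpha> / a\<^sup>2"]
    also have "(\<lambda>x. 1 / a * (sin (a * x) * x powr (- \<alpha>)) + \<alpha> / a\<^sup>2 * ((1 - cos (a * x)) * x powr (- \<alpha> - 1))) = F"
      by (simp add: F_def fun_eq_iff)
    also have "1 / a * (a * cos (a * x) * x powr (- \<alpha>) - \<alpha> * sin (a * x) * x powr (- \<alpha> - 1))
       + \<alpha> / a\<^sup>2 * (a * sin (a * x) * x powr (- \<alpha> - 1) - (\<alpha> + 1) * (1 - cos (a * x)) * x powr (- \<alpha> - 1 - 1)) = f x"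
      unfolding f_def p1 using x assms(1) by (simp add: p2 powr_minus field_simps power2_eq_square)
    finally show ?thesis
      by (simp add: has_real_derivative_iff_has_vector_derivative has_vector_derivative_at_within)
  qed
  have cont: "continuous_on {?l..?r} f"
    unfolding f_def using l by (intro continuous_intros) auto
  have "has_bochner_integral lborel (\<lambda>x. indicator {?l..?r} x *\<^sub>R f x) (F ?r - F ?l)"
    using borel_integrable_atLeastAtMost'[OF cont] integral_FTC_atLeastAtMost[OF l(2) der cont]
    by (simp add: has_bochner_integral_iff set_integrable_def)
  \<comment> \<open>The interval is the positive half of the band. Since the integrand is even, the
    whole band contributes twice as much.\<close>
  also have "(\<lambda>x. indicator {?l..?r} x *\<^sub>R f x) = (\<lambda>x. indicator {0..} x *\<^sub>R (indicator (band n) x * f x))"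
  proof
    fix x :: real
    have "x \<in> {?l..?r} \<longleftrightarrow> x \<in> {0..} \<and> x \<in> band n"
      unfolding band_def atLeastAtMost_iff atLeast_iff mem_Collect_eq using l(1) by linarith
    then show "indicator {?l..?r} x *\<^sub>R f x = indicator {0..} x *\<^sub>R (indicator (band n) x * f x)"
      by (simp add: indicator_def)
  qed
  finally have "has_bochner_integral lborel (\<lambda>x. indicator (band n) x * f x) (2 *\<^sub>R (F ?r - F ?l))"
    by (rule has_bochner_integral_even_function) (simp add: f_def indicator_def)
  then have "(\<integral>x. indicator (band n) x * f x \<partial>lborel) = 2 * (F ?r - F ?l)"
    by (simp add: has_bochner_integral_iff)
  moreover have "(\<integral>x. indicator (band n) x * f x \<partial>lborel) =
    (\<integral>x. indicator (band n) x * (cos (a * x) / \<bar>x\<bar> powr \<alpha>)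
      - \<alpha> * (\<alpha> + 1) / a\<^sup>2 * (indicator (band n) x * ((1 - cos (a * x)) / \<bar>x\<bar> powr (\<alpha> + 2))) \<partial>lborel)"
    unfolding f_def by (intro Bochner_Integration.integral_cong refl) (simp add: indicator_def)
  moreover have "\<dots> = (\<integral>x. indicator (band n) x * (cos (a * x) / \<bar>x\<bar> powr \<alpha>) \<partial>lborel)
      - \<alpha> * (\<alpha> + 1) / a\<^sup>2 * (\<integral>x. indicator (band n) x * ((1 - cos (a * x)) / \<bar>x\<bar> powr (\<alpha> + 2)) \<partial>lborel)"
    by (simp only: integral_mult_right_zero
        Bochner_Integration.integral_diff[OF band_cos_integrable integrable_mult_right[OF band_one_minus_cos_integrable]])
  ultimately show ?thesis by linarith
qed

text \<open>The boundary terms vanish at infinity because \<alpha> > 0 and near 0 because \<alpha> <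
  1. The remaining integral has exponent \<alpha> + 2 between 2 and 3, where the moment
  converges.\<close>

lemma band_cos_tendsto:
  assumes "a \<noteq> 0" "0 < \<alpha>" "\<alpha> < 1"
  shows "(\<lambda>n. \<integral>x. indicator (band n) x * (cos (a * x) / \<bar>x\<bar> powr \<alpha>) \<partial>lborel)
    \<longlonglongrightarrow> \<alpha> * (\<alpha> + 1) * cos_moment (\<alpha> + 2) * \<bar>a\<bar> powr (\<alpha> - 1)"
proof -
  define F where "F = (\<lambda>x. sin (a * x) / a * x powr (- \<alpha>) + \<alpha> / a\<^sup>2 * (1 - cos (a * x)) * x powr (- \<alpha> - 1))"
  have powr_lim: "(\<lambda>n. real (Suc n) powr (- s)) \<longlonglongrightarrow> 0" if "s > 0" for s
    using that filterlim_compose[OF filterlim_real_sequentially filterlim_Suc]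
    by (intro tendsto_neg_powr) auto
  have r: "(\<lambda>n. F (real (Suc n))) \<longlonglongrightarrow> 0"
  proof (rule Lim_null_comparison)
    show "\<forall>\<^sub>F n in sequentially. norm (F (real (Suc n)))
        \<le> 1 / \<bar>a\<bar> * real (Suc n) powr (- \<alpha>) + \<alpha> / a\<^sup>2 * 2 * real (Suc n) powr (- (\<alpha> + 1))"
    proof (intro always_eventually allI)
      fix n
      let ?x = "real (Suc n)"
      have "\<bar>F ?x\<bar> \<le> \<bar>sin (a * ?x) / a * ?x powr (- \<alpha>)\<bar> + \<bar>\<alpha> / a\<^sup>2 * (1 - cos (a * ?x)) * ?x powr (- \<alpha> - 1)\<bar>"
        unfolding F_def by (rule abs_triangle_ineq)
      also have "\<bar>sin (a * ?x) / a * ?x powr (- \<alpha>)\<bar> \<le> 1 / \<bar>a\<bar> * ?x powr (- \<alpha>)"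
        unfolding abs_mult abs_divide by (intro mult_mono divide_right_mono) auto
      also have "\<bar>\<alpha> / a\<^sup>2 * (1 - cos (a * ?x)) * ?x powr (- \<alpha> - 1)\<bar> \<le> \<alpha> / a\<^sup>2 * 2 * ?x powr (- \<alpha> - 1)"
        unfolding abs_mult using assms cos_ge_minus_one[of "a * ?x"]
        by (intro mult_mono) (auto simp del: cos_ge_minus_one)
      finally show "norm (F ?x) \<le> 1 / \<bar>a\<bar> * ?x powr (- \<alpha>) + \<alpha> / a\<^sup>2 * 2 * ?x powr (- (\<alpha> + 1))"
        by simp
    qed
    have "(\<lambda>n. 1 / \<bar>a\<bar> * real (Suc n) powr (- \<alpha>) + \<alpha> / a\<^sup>2 * 2 * real (Suc n) powr (- (\<alpha> + 1)))
      \<longlonglongrightarrow> 1 / \<bar>a\<bar> * 0 + \<alpha> / a\<^sup>2 * 2 * 0"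
      using assms by (intro tendsto_add tendsto_mult tendsto_const powr_lim) auto
    then show "(\<lambda>n. 1 / \<bar>a\<bar> * real (Suc n) powr (- \<alpha>) + \<alpha> / a\<^sup>2 * 2 * real (Suc n) powr (- (\<alpha> + 1))) \<longlonglongrightarrow> 0"
      by simp
  qed
  have l: "(\<lambda>n. F (inverse (real (Suc n)))) \<longlonglongrightarrow> 0"
  proof (rule Lim_null_comparison)
    \<comment> \<open>By |sin y| \<le> |y| and 1 - cos y \<le> y^2 / 2, both terms of
      \<open>F\<close> are of order x^(1 - \<alpha>) at x = 1 / (n + 1).\<close>
    show "\<forall>\<^sub>F n in sequentially. norm (F (inverse (real (Suc n)))) \<le> (1 + \<alpha> / 2) * real (Suc n) powr (- (1 - \<alpha>))"
    proof (intro always_eventually allI)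
      fix n
      define x where "x = inverse (real (Suc n))"
      have x: "x > 0" by (simp add: x_def)
      have "\<bar>F x\<bar> \<le> \<bar>sin (a * x) / a * x powr (- \<alpha>)\<bar> + \<bar>\<alpha> / a\<^sup>2 * (1 - cos (a * x)) * x powr (- \<alpha> - 1)\<bar>"
        unfolding F_def by (rule abs_triangle_ineq)
      also have "\<bar>sin (a * x) / a * x powr (- \<alpha>)\<bar> \<le> \<bar>a * x\<bar> / \<bar>a\<bar> * x powr (- \<alpha>)"
        unfolding abs_mult abs_divide
        using abs_sin_x_le_abs_x[of "a * x"] by (intro mult_mono divide_right_mono) (auto simp: abs_mult)
      also have "\<bar>\<alpha> / a\<^sup>2 * (1 - cos (a * x)) * x powr (- \<alpha> - 1)\<bar> \<le> \<alpha> / a\<^sup>2 * ((a * x)\<^sup>2 / 2) * x powr (- \<alpha> - 1)"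
        unfolding abs_mult using assms one_minus_cos_le[of "a * x"]
        by (intro mult_mono) auto
      also have "\<bar>a * x\<bar> / \<bar>a\<bar> * x powr (- \<alpha>) = x powr (1 - \<alpha>)"
        using x assms by (simp add: abs_mult powr_diff powr_minus field_simps)
      also have "\<alpha> / a\<^sup>2 * ((a * x)\<^sup>2 / 2) * x powr (- \<alpha> - 1) = \<alpha> / 2 * x powr (1 - \<alpha>)"
        using x assms by (simp add: powr_diff powr_minus power2_eq_square field_simps)
      also have "x powr (1 - \<alpha>) = real (Suc n) powr (- (1 - \<alpha>))"
        by (simp only: x_def powr_minus inverse_powr)
      finally show "norm (F (inverse (real (Suc n)))) \<le> (1 + \<alpha> / 2) * real (Suc n) powr (- (1 - \<alpha>))"
        unfolding x_def by (simp add: distrib_right)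
    qed
    have "(\<lambda>n. (1 + \<alpha> / 2) * real (Suc n) powr (- (1 - \<alpha>))) \<longlonglongrightarrow> (1 + \<alpha> / 2) * 0"
      using assms by (intro tendsto_mult tendsto_const powr_lim) auto
    then show "(\<lambda>n. (1 + \<alpha> / 2) * real (Suc n) powr (- (1 - \<alpha>))) \<longlonglongrightarrow> 0" by simp
  qed
  have "(\<lambda>n. \<alpha> * (\<alpha> + 1) / a\<^sup>2 * (\<integral>x. indicator (band n) x * ((1 - cos (a * x)) / \<bar>x\<bar> powr (\<alpha> + 2)) \<partial>lborel)
      + 2 * (F (real (Suc n)) - F (inverse (real (Suc n)))))
    \<longlonglongrightarrow> \<alpha> * (\<alpha> + 1) / a\<^sup>2 * (\<bar>a\<bar> powr (\<alpha> + 2 - 1) * cos_moment (\<alpha> + 2)) + 2 * (0 - 0)"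
    using assms by (intro tendsto_add tendsto_mult tendsto_diff tendsto_const r l band_one_minus_cos_tendsto) auto
  also have "\<alpha> * (\<alpha> + 1) / a\<^sup>2 * (\<bar>a\<bar> powr (\<alpha> + 2 - 1) * cos_moment (\<alpha> + 2)) + 2 * (0 - 0)
     = \<alpha> * (\<alpha> + 1) * cos_moment (\<alpha> + 2) * \<bar>a\<bar> powr (\<alpha> - 1)"
  proof -
    have "\<bar>a\<bar> powr (\<alpha> + 2 - 1) = \<bar>a\<bar> powr (\<alpha> - 1) * \<bar>a\<bar> powr 2"
      by (subst powr_add[symmetric]) simp
    also have "\<bar>a\<bar> powr 2 = a\<^sup>2" using assms by simp
    finally have "\<bar>a\<bar> powr (\<alpha> + 2 - 1) = \<bar>a\<bar> powr (\<alpha> - 1) * a\<^sup>2" .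
    then show ?thesis using assms by (simp only:) simp
  qed
  finally show ?thesis
    unfolding F_def band_cos_by_parts[OF assms(1)] .
qed

text \<open>For \<alpha> < 1 each integral converges by itself. For \<alpha> > 1 each diverges at 0,
  but in the difference cos may be replaced by cos - 1, which restores convergence. At \<alpha> = 1
  the limit would be logarithmic. The constant \<open>c\<close> does not depend on the
  frequencies.\<close>

lemma band_cos_diff_tendsto:
  assumes "0 < \<alpha>" "\<alpha> < 3" "\<alpha> \<noteq> 1"
  obtains c where "c \<noteq> 0"
    "\<And>a b. a \<noteq> 0 \<Longrightarrow> b \<noteq> 0 \<Longrightarrow>
      (\<lambda>n. (\<integral>x. indicator (band n) x * (cos (a * x) / \<bar>x\<bar> powr \<alpha>) \<partial>lborel)
         - (\<integral>x. indicator (band n) x * (cos (b * x) / \<bar>x\<bar> powr \<alpha>) \<partial>lborel))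
      \<longlonglongrightarrow> c * (\<bar>a\<bar> powr (\<alpha> - 1) - \<bar>b\<bar> powr (\<alpha> - 1))"
proof (cases "\<alpha> < 1")
  case True
  show thesis
  proof (rule that)
    show "\<alpha> * (\<alpha> + 1) * cos_moment (\<alpha> + 2) \<noteq> 0"
      using assms True cos_moment_pos[of "\<alpha> + 2"] by simp
  qed (use assms True in \<open>auto simp only: right_diff_distrib intro!: tendsto_diff band_cos_tendsto\<close>)
next
  case False
  show thesis
  proof (rule that)
    \<comment> \<open>The sign comes from cos (a x) - cos (b x) = (1 - cos (b x)) - (1 - cos (a
      x)).\<close>
    show "- cos_moment \<alpha> \<noteq> 0"
      using assms False cos_moment_pos[of \<alpha>] by simp
    fix a b :: real
    let ?I = "\<lambda>a n. \<integral>x. indicator (band n) x * ((1 - cos (a * x)) / \<bar>x\<bar> powr \<alpha>) \<partial>lborel"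
    have "\<bar>b\<bar> powr (\<alpha> - 1) * cos_moment \<alpha> - \<bar>a\<bar> powr (\<alpha> - 1) * cos_moment \<alpha>
        = - cos_moment \<alpha> * (\<bar>a\<bar> powr (\<alpha> - 1) - \<bar>b\<bar> powr (\<alpha> - 1))"
      by (simp add: algebra_simps)
    moreover have "(\<lambda>n. ?I b n - ?I a n) \<longlonglongrightarrow> \<bar>b\<bar> powr (\<alpha> - 1) * cos_moment \<alpha> - \<bar>a\<bar> powr (\<alpha> - 1) * cos_moment \<alpha>"
      using assms False by (intro tendsto_diff band_one_minus_cos_tendsto) auto
    moreover have "(\<integral>x. indicator (band n) x * (cos (a * x) / \<bar>x\<bar> powr \<alpha>) \<partial>lborel)
         - (\<integral>x. indicator (band n) x * (cos (b * x) / \<bar>x\<bar> powr \<alpha>) \<partial>lborel) = ?I b n - ?I a n" for n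
    proof -
      \<comment> \<open>The constant 1 is written as a cosine of frequency 0, so that both parts are
        truncated cosine integrals; the common part cancels in the difference.\<close>
      have I: "?I c n = (\<integral>x. indicator (band n) x * (cos (0 * x) / \<bar>x\<bar> powr \<alpha>) \<partial>lborel)
          - (\<integral>x. indicator (band n) x * (cos (c * x) / \<bar>x\<bar> powr \<alpha>) \<partial>lborel)" for c
        unfolding Bochner_Integration.integral_diff[OF band_cos_integrable band_cos_integrable, symmetric]
        by (intro Bochner_Integration.integral_cong refl) (simp add: indicator_def diff_divide_distrib)
      show ?thesis unfolding I by simp
    qed
    ultimately show "(\<lambda>n. (\<integral>x. indicator (band n) x * (cos (a * x) / \<bar>x\<bar> powr \<alpha>) \<partial>lborel)
         - (\<integral>x. indicator (band n) x * (cos (b * x) / \<bar>x\<bar> powr \<alpha>) \<partial>lborel))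
      \<longlonglongrightarrow> - cos_moment \<alpha> * (\<bar>a\<bar> powr (\<alpha> - 1) - \<bar>b\<bar> powr (\<alpha> - 1))"
      by (simp only:)
  qed
qed

text \<open>The reflection x \<mapsto> - x preserves the band and conjugates the integrand, so the
  integral equals its own conjugate and is real.\<close>

lemma band_cis_integral:
  "integrable lborel (\<lambda>x. indicator (band n) x * (cis (a * x) / of_real (\<bar>x\<bar> powr \<alpha>)))"
  "(\<integral>x. indicator (band n) x * (cis (a * x) / of_real (\<bar>x\<bar> powr \<alpha>)) \<partial>lborel)
    = of_real (\<integral>x. indicator (band n) x * (cos (a * x) / \<bar>x\<bar> powr \<alpha>) \<partial>lborel)"
proof -
  let ?g = "\<lambda>x. indicator (band n) x * (cis (a * x) / of_real (\<bar>x\<bar> powr \<alpha>))"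
  show int: "integrable lborel ?g"
    using zero_notin_band by (intro integrable_band continuous_intros) auto
  have "?g (- x) = cnj (?g x)" for x
    by (simp add: cis_cnj indicator_def)
  then have reflect: "(\<integral>x. ?g (- x) \<partial>lborel) = (\<integral>x. cnj (?g x) \<partial>lborel)"
    by (simp only:)
  have "(\<integral>x. ?g x \<partial>lborel) = (\<integral>x. ?g (- x) \<partial>lborel)"
    using lborel_integral_real_affine[of "- 1" ?g 0] by simp
  also note reflect
  also have "(\<integral>x. cnj (?g x) \<partial>lborel) = cnj (\<integral>x. ?g x \<partial>lborel)"
    by (rule Bochner_Integration.integral_cnj)
  finally have "(\<integral>x. ?g x \<partial>lborel) = of_real (Re (\<integral>x. ?g x \<partial>lborel))"
    by (simp add: complex_eq_iff)
  also have "Re (\<integral>x. ?g x \<partial>lborel) = (\<integral>x. Re (?g x) \<partial>lborel)"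
    by (rule integral_Re[OF int, symmetric])
  also have "\<dots> = (\<integral>x. indicator (band n) x * (cos (a * x) / \<bar>x\<bar> powr \<alpha>) \<partial>lborel)"
    by (intro Bochner_Integration.integral_cong refl) (simp add: indicator_def)
  finally show "(\<integral>x. ?g x \<partial>lborel) = of_real (\<integral>x. indicator (band n) x * (cos (a * x) / \<bar>x\<bar> powr \<alpha>) \<partial>lborel)" .
qed

section \<open>One coordinate factor of the harmonizable kernel and its transform\<close>

definition factor_kernel :: "real \<Rightarrow> real \<Rightarrow> real \<Rightarrow> complex" where
  "factor_kernel \<alpha> t x = (exp (\<i> * of_real (t * x)) - 1) / of_real (\<bar>x\<bar> powr \<alpha>)"

lemma factor_kernel_0 [simp]: "factor_kernel \<alpha> t 0 = 0"
  by (simp add: factor_kernel_def)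

lemma measurable_factor_kernel [measurable]: "factor_kernel \<alpha> t \<in> borel_measurable borel"
  unfolding factor_kernel_def[abs_def] by measurable

lemma integrable_band_factor_kernel:
  "integrable lborel (\<lambda>x. indicator (band n) x * factor_kernel \<alpha> t x)"
  unfolding factor_kernel_def using zero_notin_band by (intro integrable_band continuous_intros) auto

text \<open>The squared modulus of exp (i t x) - 1 is 2 (1 - cos (t x)), so the exponent becomes 2
  \<alpha>, between 1 and 3. With \<alpha> = H + 1/2 this is the range 0 < H < 1.\<close>

lemma integrable_factor_kernel_sq:
  assumes "1 / 2 < \<alpha>" "\<alpha> < 3 / 2"
  shows "integrable lborel (\<lambda>x. (norm (factor_kernel \<alpha> t x))\<^sup>2)"
proof -
  have "(norm (factor_kernel \<alpha> t x))\<^sup>2 = 2 * ((1 - cos (t * x)) / \<bar>x\<bar> powr (2 * \<alpha>))" for x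
  proof -
    have "(norm (cis (t * x) - 1))\<^sup>2 = 2 * (1 - cos (t * x))"
      using sin_cos_squared_add[of "t * x"] by (simp add: cmod_power2 power2_diff)
    moreover have "(\<bar>x\<bar> powr \<alpha>)\<^sup>2 = \<bar>x\<bar> powr (2 * \<alpha>)"
      by (simp add: power2_eq_square powr_add[symmetric])
    ultimately show ?thesis
      by (simp add: factor_kernel_def norm_divide power_divide cis_conv_exp)
  qed
  then show ?thesis
    using assms by (simp only:) (intro integrable_mult_right integrable_one_minus_cos; simp)
qed

text \<open>Multiplying exp (i t x) - 1 by exp (- i x u) leaves the difference of two exponentials
  with frequencies t - u and - u; both are nonzero under the stated conditions. The constant is
  obtained before \<open>t\<close> and \<open>u\<close> are fixed.\<close>

lemma factor_kernel_transform_tendsto: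
  assumes "0 < \<alpha>" "\<alpha> < 3" "\<alpha> \<noteq> 1"
  obtains c where "c \<noteq> 0"
    "\<And>t u. u \<noteq> 0 \<Longrightarrow> u \<noteq> t \<Longrightarrow>
      (\<lambda>n. \<integral>x. cis (- (x * u)) * (indicator (band n) x * factor_kernel \<alpha> t x) \<partial>lborel)
        \<longlonglongrightarrow> of_real (c * (\<bar>t - u\<bar> powr (\<alpha> - 1) - \<bar>u\<bar> powr (\<alpha> - 1)))"
proof -
  obtain c where c: "c \<noteq> 0"
    "\<And>a b. a \<noteq> 0 \<Longrightarrow> b \<noteq> 0 \<Longrightarrow>
      (\<lambda>n. (\<integral>x. indicator (band n) x * (cos (a * x) / \<bar>x\<bar> powr \<alpha>) \<partial>lborel)
         - (\<integral>x. indicator (band n) x * (cos (b * x) / \<bar>x\<bar> powr \<alpha>) \<partial>lborel))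
      \<longlonglongrightarrow> c * (\<bar>a\<bar> powr (\<alpha> - 1) - \<bar>b\<bar> powr (\<alpha> - 1))"
    using band_cos_diff_tendsto[OF assms] by blast
  show thesis
  proof (rule that[OF c(1)])
    fix t u :: real
    assume u: "u \<noteq> 0" "u \<noteq> t"
    have "(\<integral>x. cis (- (x * u)) * (indicator (band n) x * factor_kernel \<alpha> t x) \<partial>lborel)
      = of_real ((\<integral>x. indicator (band n) x * (cos ((t - u) * x) / \<bar>x\<bar> powr \<alpha>) \<partial>lborel)
         - (\<integral>x. indicator (band n) x * (cos ((- u) * x) / \<bar>x\<bar> powr \<alpha>) \<partial>lborel))" for n
    proof -
      have "cis (- (x * u)) * (indicator (band n) x * factor_kernel \<alpha> t x)
        = indicator (band n) x * (cis ((t - u) * x) / of_real (\<bar>x\<bar> powr \<alpha>))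
        - indicator (band n) x * (cis ((- u) * x) / of_real (\<bar>x\<bar> powr \<alpha>))" for x
      proof -
        have "cis ((t - u) * x) = cis (- (x * u)) * cis (t * x)"
          by (simp add: cis_mult algebra_simps)
        moreover have "factor_kernel \<alpha> t x = (cis (t * x) - 1) / of_real (\<bar>x\<bar> powr \<alpha>)"
          by (simp add: factor_kernel_def cis_conv_exp)
        ultimately show ?thesis
          by (simp only:) (simp add: algebra_simps diff_divide_distrib)
      qed
      then have "(\<integral>x. cis (- (x * u)) * (indicator (band n) x * factor_kernel \<alpha> t x) \<partial>lborel)
        = (\<integral>x. indicator (band n) x * (cis ((t - u) * x) / of_real (\<bar>x\<bar> powr \<alpha>)) \<partial>lborel)
          - (\<integral>x. indicator (band n) x * (cis ((- u) * x) / of_real (\<bar>x\<bar> powr \<alpha>)) \<partial>lborel)"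
        by (simp only: Bochner_Integration.integral_diff[OF band_cis_integral(1) band_cis_integral(1)])
      then show ?thesis by (simp only: band_cis_integral(2) of_real_diff)
    qed
    then show "(\<lambda>n. \<integral>x. cis (- (x * u)) * (indicator (band n) x * factor_kernel \<alpha> t x) \<partial>lborel)
        \<longlonglongrightarrow> of_real (c * (\<bar>t - u\<bar> powr (\<alpha> - 1) - \<bar>u\<bar> powr (\<alpha> - 1)))"
      using u c(2)[of "t - u" "- u"] by (simp only: tendsto_of_real_iff) simp
  qed
qed

section \<open>Products over the coordinates\<close>

lemma inj_axis_1: "inj (\<lambda>m::'n::finite. axis m (1::real))"
  by (simp add: inj_def axis_eq_axis)

lemma prod_Basis_vec:
  "(\<Prod>b\<in>(Basis :: (real ^ 'n) set). f b) = (\<Prod>m\<in>UNIV. f (axis m 1))"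
proof -
  have "(Basis :: (real ^ 'n) set) = range (\<lambda>m. axis m 1)"
    by (auto simp: Basis_vec_def)
  then have "(\<Prod>b\<in>(Basis :: (real ^ 'n) set). f b) = prod f (range (\<lambda>m. axis m 1))"
    by (rule arg_cong)
  also have "\<dots> = (\<Prod>m\<in>UNIV. f (axis m 1))"
    by (subst prod.reindex[OF inj_axis_1]) simp
  finally show ?thesis .
qed

lemma integrable_vec_prod:
  fixes f :: "'n::finite \<Rightarrow> real \<Rightarrow> 'c::{real_normed_field,banach,second_countable_topology}"
  assumes "\<And>m. integrable lborel (f m)"
  shows "integrable lborel (\<lambda>x :: real ^ 'n. \<Prod>m\<in>UNIV. f m (x $ m))"
    and "(\<integral>x. (\<Prod>m\<in>UNIV. f m (x $ m)) \<partial>(lborel :: (real ^ 'n) measure)) = (\<Prod>m\<in>UNIV. \<integral>x. f m x \<partial>lborel)"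
proof -
  \<comment> \<open>Reindexes the factors from coordinates to basis vectors, the form in which the
    product lemma is stated.\<close>
  define g where "g b = f (inv (\<lambda>m. axis m 1 :: real ^ 'n) b)" for b
  have g: "g (axis m 1) = f m" for m
    unfolding g_def inv_f_f[OF inj_axis_1] ..
  have int: "integrable lborel (g b)" for b
    unfolding g_def by (rule assms)
  have eq: "(\<Prod>b\<in>Basis. g b (x \<bullet> b)) = (\<Prod>m\<in>UNIV. f m (x $ m))" for x
    by (simp add: prod_Basis_vec g inner_axis)
  show "integrable lborel (\<lambda>x :: real ^ 'n. \<Prod>m\<in>UNIV. f m (x $ m))"
    using integrable_lborel_prod(1)[of g, OF int] by (simp only: eq)
  show "(\<integral>x. (\<Prod>m\<in>UNIV. f m (x $ m)) \<partial>(lborel :: (real ^ 'n) measure)) = (\<Prod>m\<in>UNIV. \<integral>x. f m x \<partial>lborel)"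
    using integrable_lborel_prod(2)[of g, OF int] by (simp only: eq prod_Basis_vec g)
qed

text \<open>The character exp (- i x u) is itself a product over the coordinates.\<close>

lemma fourier_L1_vec_prod:
  fixes f :: "'n::finite \<Rightarrow> real \<Rightarrow> complex"
  assumes "\<And>m. integrable lborel (f m)"
  shows "fourier_L1 (\<lambda>x :: real ^ 'n. \<Prod>m\<in>UNIV. f m (x $ m)) u
    = (\<Prod>m\<in>UNIV. \<integral>x. cis (- (x * u $ m)) * f m x \<partial>lborel)"
proof -
  have "integrable lborel (\<lambda>x. cis (- (x * u $ m)) * f m x)" for m
    by (rule Bochner_Integration.integrable_bound[OF assms]) (use assms[of m] in \<open>auto simp: norm_mult\<close>)
  from integrable_vec_prod(2)[OF this] show ?thesis
    by (simp add: fourier_L1_def inner_vec_def sum_negf[symmetric] cis_sum prod.distrib)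
qed

lemma AE_vec_component_neq:
  "AE u in lborel. (u :: real ^ 'n) $ m \<noteq> c"
proof -
  have "negligible {u :: real ^ 'n. axis m 1 \<bullet> u = c}"
    by (intro negligible_hyperplane) (simp add: axis_eq_0_iff)
  \<comment> \<open>A negligible set is null for the completed measure; closedness makes it Borel
    and hence null for \<open>lborel\<close>.\<close>
  moreover have "closed {u :: real ^ 'n. axis m 1 \<bullet> u = c}"
    by (rule closed_hyperplane)
  ultimately have "{u :: real ^ 'n. axis m 1 \<bullet> u = c} \<in> null_sets lborel"
    by (simp add: negligible_iff_null_sets null_sets_completion_iff borel_closed)
  then have "AE u in lborel. u \<notin> {u :: real ^ 'n. axis m 1 \<bullet> u = c}"
    by (rule AE_not_in)
  then show ?thesis by (simp add: inner_axis' )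
qed

lemma L2C_cmult:
  assumes "f \<in> L2C"
  shows "(\<lambda>u. a * f u) \<in> L2C"
  using assms by (auto simp: L2C_def norm_mult power_mult_distrib)

section \<open>The two kernels on R^N\<close>

lemma mfbs_kernel_measurable [measurable]: "mfbs_kernel H t \<in> borel_measurable borel"
  unfolding mfbs_kernel_def[abs_def] by measurable

lemma harmonizable_kernel_eq:
  "harmonizable_kernel H t \<xi> = (\<Prod>m\<in>UNIV. factor_kernel (H t $ m + 1 / 2) (t $ m) (\<xi> $ m))"
  by (simp add: harmonizable_kernel_def factor_kernel_def)

text \<open>The transform of the truncated product factorises, so the one-dimensional limits apply
  coordinatewise. The constant is the product of the coordinate constants, nonzero because each of
  them is.\<close>

lemma fourier_L2_harmonizable_kernel:
  fixes H :: "real ^ 'n \<Rightarrow> real ^ 'n"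
  assumes H: "\<And>m. 0 < H t $ m \<and> H t $ m < 1" "\<And>m. H t $ m \<noteq> 1 / 2"
  obtains c :: real where "c \<noteq> 0"
    "is_fourier_L2 (harmonizable_kernel H t) (\<lambda>u. of_real c * mfbs_kernel H t u)"
proof -
  define k where "k m = factor_kernel (H t $ m + 1 / 2) (t $ m)" for m
  define F where "F n \<xi> = (\<Prod>m\<in>UNIV. indicator (band n) (\<xi> $ m) * k m (\<xi> $ m))"
    for n and \<xi> :: "real ^ 'n"
  let ?\<phi> = "harmonizable_kernel H t"
  have \<phi>: "?\<phi> \<xi> = (\<Prod>m\<in>UNIV. k m (\<xi> $ m))" for \<xi>
    by (simp add: harmonizable_kernel_eq k_def)
  have [measurable]: "k m \<in> borel_measurable borel" for m
    unfolding k_def by measurable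
  have [measurable]: "?\<phi> \<in> borel_measurable borel"
    unfolding \<phi>[abs_def] by measurable
  have [measurable]: "F n \<in> borel_measurable borel" for n
    unfolding F_def[abs_def] by measurable
  have "integrable lborel (\<lambda>\<xi> :: real ^ 'n. \<Prod>m\<in>UNIV. (norm (k m (\<xi> $ m)))\<^sup>2)"
    unfolding k_def using H by (intro integrable_vec_prod integrable_factor_kernel_sq) auto
  then have \<phi>_sq: "integrable lborel (\<lambda>\<xi>. (norm (?\<phi> \<xi>))\<^sup>2)"
    by (simp add: \<phi> prod_norm[symmetric] prod_power_distrib)
  then have \<phi>_L2: "?\<phi> \<in> L2C" by (simp add: L2C_def)
  have F_le: "norm (F n \<xi>) \<le> norm (?\<phi> \<xi>)" for n \<xi>
    unfolding F_def \<phi> prod_norm[symmetric]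
    by (intro prod_mono) (auto simp: norm_mult indicator_def)
  have F_L1: "integrable lborel (F n)" for n
    unfolding F_def[abs_def] k_def by (intro integrable_vec_prod integrable_band_factor_kernel)
  have F_L2: "F n \<in> L2C" for n
  proof -
    have "integrable lborel (\<lambda>\<xi>. (norm (F n \<xi>))\<^sup>2)"
      by (rule Bochner_Integration.integrable_bound[OF \<phi>_sq]) (auto intro!: power_mono F_le)
    then show ?thesis by (simp add: L2C_def)
  qed
  have F_tendsto: "(\<lambda>n. F n \<xi>) \<longlonglongrightarrow> ?\<phi> \<xi>" for \<xi>
    unfolding F_def \<phi> by (intro tendsto_prod tendsto_indicator_band) (simp add: k_def)
  have conv: "L2_tendsto F ?\<phi>"
  proof -
    have "(\<lambda>n. \<integral>\<^sup>+ \<xi>. ennreal ((norm (F n \<xi> - ?\<phi> \<xi>))\<^sup>2) \<partial>lborel) \<longlonglongrightarrow> (\<integral>\<^sup>+ \<xi>. 0 \<partial>(lborel :: (real ^ 'n) measure))"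
    proof (rule nn_integral_dominated_convergence)
      \<comment> \<open>The truncated kernel and its limit both have modulus at most that of
        \<open>?\<phi> \<xi>\<close>; the factor 4 is the square of 2.\<close>
      show "AE \<xi> in lborel. ennreal ((norm (F n \<xi> - ?\<phi> \<xi>))\<^sup>2) \<le> ennreal (4 * (norm (?\<phi> \<xi>))\<^sup>2)" for n
      proof (intro AE_I2 ennreal_leI)
        fix \<xi>
        have "norm (F n \<xi> - ?\<phi> \<xi>) \<le> 2 * norm (?\<phi> \<xi>)"
          using norm_triangle_ineq4[of "F n \<xi>" "?\<phi> \<xi>"] F_le[of n \<xi>] by simp
        then have "(norm (F n \<xi> - ?\<phi> \<xi>))\<^sup>2 \<le> (2 * norm (?\<phi> \<xi>))\<^sup>2"
          by (intro power_mono) auto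
        then show "(norm (F n \<xi> - ?\<phi> \<xi>))\<^sup>2 \<le> 4 * (norm (?\<phi> \<xi>))\<^sup>2"
          by (simp add: power_mult_distrib)
      qed
      show "(\<integral>\<^sup>+ \<xi>. ennreal (4 * (norm (?\<phi> \<xi>))\<^sup>2) \<partial>lborel) < \<infinity>"
        using \<phi>_L2
        by (simp add: L2C_iff sqnorm_L2_def ennreal_mult' nn_integral_cmult ennreal_mult_less_top)
      show "AE \<xi> in lborel. (\<lambda>n. ennreal ((norm (F n \<xi> - ?\<phi> \<xi>))\<^sup>2)) \<longlonglongrightarrow> 0"
      proof (intro AE_I2)
        fix \<xi>
        have "(\<lambda>n. (norm (F n \<xi> - ?\<phi> \<xi>))\<^sup>2) \<longlonglongrightarrow> (norm (?\<phi> \<xi> - ?\<phi> \<xi>))\<^sup>2"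
          by (intro tendsto_intros F_tendsto)
        then have "(\<lambda>n. ennreal ((norm (F n \<xi> - ?\<phi> \<xi>))\<^sup>2)) \<longlonglongrightarrow> ennreal ((norm (?\<phi> \<xi> - ?\<phi> \<xi>))\<^sup>2)"
          by (rule tendsto_ennrealI)
        then show "(\<lambda>n. ennreal ((norm (F n \<xi> - ?\<phi> \<xi>))\<^sup>2)) \<longlonglongrightarrow> 0" by simp
      qed
    qed auto
    then show ?thesis by (simp add: L2_tendsto_def)
  qed
  \<comment> \<open>Naming the convergence lets one constant per coordinate be chosen that serves
    all admissible \<open>u\<close> at once.\<close>
  define conv_at where "conv_at m c u \<longleftrightarrow>
      (\<lambda>n. \<integral>x. cis (- (x * u)) * (indicator (band n) x * k m x) \<partial>lborel)
        \<longlonglongrightarrow> of_real (c * (\<bar>t $ m - u\<bar> powr (H t $ m - 1 / 2) - \<bar>u\<bar> powr (H t $ m - 1 / 2)))"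
    for m and c u :: real
  have "\<exists>c :: real. c \<noteq> 0 \<and> (\<forall>u. u \<noteq> 0 \<longrightarrow> u \<noteq> t $ m \<longrightarrow> conv_at m c u)" for m
  proof -
    have "0 < H t $ m + 1 / 2" "H t $ m + 1 / 2 < 3" "H t $ m + 1 / 2 \<noteq> 1"
      using H(1)[of m] H(2)[of m] by auto
    then obtain c where "c \<noteq> 0" and c: "\<And>s u. u \<noteq> 0 \<Longrightarrow> u \<noteq> s \<Longrightarrow>
      (\<lambda>n. \<integral>x. cis (- (x * u)) * (indicator (band n) x * factor_kernel (H t $ m + 1 / 2) s x) \<partial>lborel)
        \<longlonglongrightarrow> of_real (c * (\<bar>s - u\<bar> powr (H t $ m + 1 / 2 - 1) - \<bar>u\<bar> powr (H t $ m + 1 / 2 - 1)))"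
      using factor_kernel_transform_tendsto[of "H t $ m + 1 / 2"] by blast
    have "H t $ m + 1 / 2 - 1 = H t $ m - 1 / 2" by simp
    then have "conv_at m c u" if "u \<noteq> 0" "u \<noteq> t $ m" for u
      using c[OF that] by (simp only: conv_at_def k_def)
    with \<open>c \<noteq> 0\<close> show ?thesis by blast
  qed
  then obtain c :: "'n \<Rightarrow> real" where c0: "\<And>m. c m \<noteq> 0"
    and c: "\<And>m u. u \<noteq> 0 \<Longrightarrow> u \<noteq> t $ m \<Longrightarrow> conv_at m (c m) u"
    by metis
  \<comment> \<open>The exceptional points lie on finitely many coordinate hyperplanes.\<close>
  have "AE u in lborel. \<forall>m. u $ m \<noteq> 0 \<and> u $ m \<noteq> t $ m"
    by (simp add: AE_all_countable AE_vec_component_neq)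
  then have lim: "AE u in lborel. (\<lambda>n. fourier_L1 (F n) u) \<longlonglongrightarrow> of_real (\<Prod>m\<in>UNIV. c m) * mfbs_kernel H t u"
  proof eventually_elim
    case (elim u)
    have "(\<lambda>n. \<Prod>m\<in>UNIV. \<integral>x. cis (- (x * u $ m)) * (indicator (band n) x * k m x) \<partial>lborel)
      \<longlonglongrightarrow> (\<Prod>m\<in>UNIV. of_real (c m * (\<bar>t $ m - u $ m\<bar> powr (H t $ m - 1 / 2) - \<bar>u $ m\<bar> powr (H t $ m - 1 / 2))))"
      using elim by (intro tendsto_prod c[unfolded conv_at_def]) auto
    moreover have "fourier_L1 (F n) u = (\<Prod>m\<in>UNIV. \<integral>x. cis (- (x * u $ m)) * (indicator (band n) x * k m x) \<partial>lborel)" for n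
      unfolding F_def[abs_def] k_def by (intro fourier_L1_vec_prod integrable_band_factor_kernel)
    moreover have "(\<Prod>m\<in>UNIV. of_real (c m * (\<bar>t $ m - u $ m\<bar> powr (H t $ m - 1 / 2) - \<bar>u $ m\<bar> powr (H t $ m - 1 / 2))))
        = of_real (\<Prod>m\<in>UNIV. c m) * mfbs_kernel H t u"
      by (simp add: mfbs_kernel_def prod.distrib)
    ultimately show ?case by simp
  qed
  show thesis
  proof (rule that)
    show "(\<Prod>m\<in>UNIV. c m) \<noteq> 0" using c0 by simp
    show "is_fourier_L2 ?\<phi> (\<lambda>u. of_real (\<Prod>m\<in>UNIV. c m) * mfbs_kernel H t u)"
    proof (rule is_fourier_L2_pointwise_limit[where F = F])
      show "(\<lambda>u. of_real (\<Prod>m\<in>UNIV. c m) * mfbs_kernel H t u) \<in> borel_measurable borel"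
        by (intro borel_measurable_times borel_measurable_const mfbs_kernel_measurable)
    qed (fact F_L1 F_L2 \<phi>_L2 conv lim)+
  qed
qed

text \<open>With exponent 0 both powers in this coordinate equal 1, except at base 0, where
  \<open>0 powr 0 = 0\<close>. Off two hyperplanes this factor is therefore 1 - 1 = 0.\<close>

lemma mfbs_kernel_AE_zero:
  assumes "H t $ m = 1 / 2"
  shows "AE u in lborel. mfbs_kernel H t u = 0"
  using AE_vec_component_neq[of m 0] AE_vec_component_neq[of m "t $ m"]
proof eventually_elim
  case (elim u)
  have "\<bar>t $ m - u $ m\<bar> powr (H t $ m - 1 / 2) - \<bar>u $ m\<bar> powr (H t $ m - 1 / 2) = 0"
    using elim unfolding assms by simp
  then have "(\<Prod>m\<in>UNIV. \<bar>t $ m - u $ m\<bar> powr (H t $ m - 1 / 2) - \<bar>u $ m\<bar> powr (H t $ m - 1 / 2)) = 0"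
    by (intro prod_zero) auto
  then show ?case by (simp add: mfbs_kernel_def)
qed

text \<open>Joins the regular and the degenerate case. The disjunction leaves \<open>f\<close> free
  when l = 0, so the transform of the harmonizable kernel enters only when every
  \<open>H t $ m\<close> differs from 1/2.\<close>

lemma mfbs_kernel_representation:
  fixes H :: "real ^ 'n \<Rightarrow> real ^ 'n"
  assumes H: "\<And>m. 0 < H t $ m \<and> H t $ m < 1"
  shows "mfbs_kernel H t \<in> L2C \<and> (\<exists>l :: real. \<exists>f\<in>L2C. (AE u in lborel. mfbs_kernel H t u = of_real l * f u)
    \<and> (l = 0 \<or> f = fourier_L2 (harmonizable_kernel H t)))"
proof (cases "\<exists>m. H t $ m = 1 / 2")
  case True
  then have z: "AE u in lborel. mfbs_kernel H t u = 0"
    using mfbs_kernel_AE_zero by blast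
  have "sqnorm_L2 (mfbs_kernel H t) = (\<integral>\<^sup>+u. 0 \<partial>(lborel :: (real ^ 'n) measure))"
    unfolding sqnorm_L2_def by (rule nn_integral_cong_AE) (use z in eventually_elim, simp)
  then have "mfbs_kernel H t \<in> L2C" by (simp add: L2C_iff)
  \<comment> \<open>The kernel itself serves as \<open>f\<close>, since almost everywhere it equals
    0 times itself.\<close>
  with z show ?thesis
    by (intro conjI exI[of _ 0] bexI[of _ "mfbs_kernel H t"]) auto
next
  case False
  then obtain c where c: "c \<noteq> 0"
    and *: "is_fourier_L2 (harmonizable_kernel H t) (\<lambda>u. of_real c * mfbs_kernel H t u)"
    using fourier_L2_harmonizable_kernel[of H t, OF H] by blast
  \<comment> \<open>Since c \<noteq> 0, the relation can be inverted: the multiplier is 1 /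
    c.\<close>
  have "(\<lambda>u. of_real (1 / c) * (of_real c * mfbs_kernel H t u)) \<in> L2C"
    using * by (intro L2C_cmult[of "\<lambda>u. of_real c * mfbs_kernel H t u"]) (simp add: is_fourier_L2_def)
  then have "mfbs_kernel H t \<in> L2C" using c by simp
  moreover have "AE u in lborel. mfbs_kernel H t u = of_real (1 / c) * fourier_L2 (harmonizable_kernel H t) u"
    using fourier_L2_AE_eq(2)[OF *] by eventually_elim (use c in simp)
  ultimately show ?thesis
    using fourier_L2_AE_eq(1)[OF *] by blast
qed

section \<open>Passage from the kernels to the processes\<close>

theorem proposition10:
  fixes M :: "'w measure"
    and W :: "(real ^ 'n \<Rightarrow> complex) \<Rightarrow> 'w \<Rightarrow> complex"
    and H :: "real ^ 'n \<Rightarrow> real ^ 'n"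
  assumes "prob_space M"
    and "complex_isonormal M W"
    and "H \<in> borel_measurable (restrict_space borel orthant)"
    and "\<And>t m. t \<in> orthant \<Longrightarrow> 0 < H t $ m \<and> H t $ m < 1"
  shows "\<exists>\<Lambda> :: real ^ 'n \<Rightarrow> real.
    indistinguishable M orthant (multifractional_sheet W H)
      (\<lambda>t \<omega>. complex_of_real (\<Lambda> t) * harmonizable_sheet W H t \<omega>)"
proof -
  have rep: "mfbs_kernel H t \<in> L2C \<and> (\<exists>l :: real. \<exists>f\<in>L2C. (AE u in lborel. mfbs_kernel H t u = of_real l * f u)
    \<and> (l = 0 \<or> f = fourier_L2 (harmonizable_kernel H t)))" if "t \<in> orthant" for t
    by (rule mfbs_kernel_representation) (rule assms(4)[OF that])
  have "\<forall>t\<in>orthant. \<exists>l :: real. \<exists>f\<in>L2C. (AE u in lborel. mfbs_kernel H t u = of_real l * f u)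
    \<and> (l = 0 \<or> f = fourier_L2 (harmonizable_kernel H t))"
    by (rule ballI) (rule conjunct2[OF rep])
  \<comment> \<open>The multiplier is chosen from the kernels alone, before any sample point is
    considered, and is thus deterministic.\<close>
  from bchoice[OF this] obtain \<Lambda> :: "real ^ 'n \<Rightarrow> real" where \<Lambda>: "\<forall>t\<in>orthant.
    \<exists>f\<in>L2C. (AE u in lborel. mfbs_kernel H t u = of_real (\<Lambda> t) * f u)
    \<and> (\<Lambda> t = 0 \<or> f = fourier_L2 (harmonizable_kernel H t))"
    by (elim exE)
  have ae_eq: "\<forall>f\<in>L2C. \<forall>g\<in>L2C. (AE u in lborel. f u = g u) \<longrightarrow> W f = W g"
    and lin: "AE \<omega> in M. \<forall>f\<in>L2C. \<forall>g\<in>L2C. \<forall>a b.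
      W (\<lambda>u. a * f u + b * g u) \<omega> = a * W f \<omega> + b * W g \<omega>"
    using assms(2) unfolding complex_isonormal_def by - (elim conjE, assumption)+
  \<comment> \<open>The null set is the one outside which \<open>W\<close> is linear; it does not
    depend on \<open>t\<close>, and this yields indistinguishability.\<close>
  from lin have "AE \<omega> in M. \<forall>t\<in>orthant. multifractional_sheet W H t \<omega>
      = complex_of_real (\<Lambda> t) * harmonizable_sheet W H t \<omega>"
  proof eventually_elim
    case (elim \<omega>)
    show ?case
    proof
      fix t :: "real ^ 'n" assume t: "t \<in> orthant"
      obtain f where f: "f \<in> L2C" "AE u in lborel. mfbs_kernel H t u = of_real (\<Lambda> t) * f u"
        "\<Lambda> t = 0 \<or> f = fourier_L2 (harmonizable_kernel H t)"
        using bspec[OF \<Lambda> t] by (elim bexE conjE)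
      \<comment> \<open>Kernels equal almost everywhere give the same variable at every sample
        point, so this step adds no exceptional set.\<close>
      have "W (mfbs_kernel H t) = W (\<lambda>u. of_real (\<Lambda> t) * f u)"
        by (rule ae_eq[rule_format, OF conjunct1[OF rep[OF t]] L2C_cmult[OF f(1)] f(2)])
      \<comment> \<open>Homogeneity is linearity with both functions equal to \<open>f\<close> and
        second coefficient 0.\<close>
      then have "W (mfbs_kernel H t) \<omega> = of_real (\<Lambda> t) * W f \<omega>"
        using elim[rule_format, OF f(1) f(1), of "of_real (\<Lambda> t)" 0] by simp
      then show "multifractional_sheet W H t \<omega> = complex_of_real (\<Lambda> t) * harmonizable_sheet W H t \<omega>"
        using f(3) by (auto simp: multifractional_sheet_def harmonizable_sheet_def fourier_isonormal_def)
    qed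
  qed
  then show ?thesis
    unfolding indistinguishable_def by (intro exI[of _ \<Lambda>])
qed

end
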